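(* Let $0<r<R$ and, for $t\in[0,R-r)$, let $\Omega_t:=B_R(0)\setminus\overline{B_r(te_1)}\subset\mathbb{R}^2$, where $e_1=(1,0)$. If $R<\frac12$, then $t\mapsto\tau_1(\Omega_t)$ is strictly increasing on $[0,R-r)$.
   Context: For a bounded open set $\Omega\subset\mathbb{R}^2$, the Logarithmic potential operator $\mathcal{L}$ on $L^2(\Omega)$ (real-valued functions) is $\mathcal{L}u(x)=\frac{1}{2\pi}\int_\Omega \log\frac{1}{|x-y|}\,u(y)\,dy$; it is self-adjoint and compact. Its largest eigenvalue is denoted $\tau_1(\Omega)$ and satisfies $\tau_1(\Omega)=\sup\{E(u):u\in L^2(\Omega),\ \|u\|_{L^2(\Omega)}=1\}$, where $E(u)=\frac{1}{2\pi}\int_\Omega\int_\Omega\log\frac{1}{|x-y|}u(x)u(y)\,dx\,dy$. $B_\rho(x)$ is the open ball in $\mathbb{R}^2$ with centre $x$ and radius $\rho$, and $\overline{B_\rho(x)}$ is the corresponding closed ball. *)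

theory Defs
  imports "HOL-Analysis.Analysis"
begin

(* L2_on consists of functions rather than of classes modulo null sets. Only the values on
   Omega matter, and equality in L^2(Omega) is rendered as equality almost everywhere. *)
definition L2_on :: "(real^2) set \<Rightarrow> (real^2 \<Rightarrow> real) set" where
  "L2_on \<Omega> = {u. u \<in> borel_measurable (lebesgue_on \<Omega>) \<and>
                 integrable (lebesgue_on \<Omega>) (\<lambda>x. (u x)\<^sup>2)}"

(* On the diagonal HOL gives ln (1 / 0) = 0 instead of infinity; for fixed x this concerns the
   single point y = x, which does not affect the integral. *)
definition log_potential :: "(real^2) set \<Rightarrow> (real^2 \<Rightarrow> real) \<Rightarrow> real^2 \<Rightarrow> real" where
  "log_potential \<Omega> u x =
     1 / (2 * pi) * (LINT y|lebesgue_on \<Omega>. ln (1 / norm (x - y)) * u y)"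

definition log_potential_eigenvalue :: "(real^2) set \<Rightarrow> real \<Rightarrow> bool" where
  "log_potential_eigenvalue \<Omega> \<mu> \<longleftrightarrow>
     (\<exists>u \<in> L2_on \<Omega>. \<not> (AE x in lebesgue_on \<Omega>. u x = 0) \<and>
        (AE x in lebesgue_on \<Omega>. log_potential \<Omega> u x = \<mu> * u x))"

(* The largest eigenvalue. It exists for every nonempty bounded open Omega, because the
   operator is compact and self-adjoint and its quadratic form takes positive values. *)
definition tau1 :: "(real^2) set \<Rightarrow> real" where
  "tau1 \<Omega> = (GREATEST \<mu>. log_potential_eigenvalue \<Omega> \<mu>)"

definition eccentric_annulus :: "real \<Rightarrow> real \<Rightarrow> real \<Rightarrow> (real^2) set" where
  "eccentric_annulus R r t = ball 0 R - cball (t *\<^sub>R axis 1 1) r"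

end

theory Submission
  imports Defs "HOL-Complex_Analysis.Great_Picard"
begin

text \<open>
Let $t < s$ and let $\sigma$ be the reflection in the vertical line midway between $te_1$ and $se_1$.
Polarization with respect to this line replaces the values of a function $u$ on each mirror pair by
their maximum on the left and their minimum on the right. It turns functions supported in $\Omega_t$
into functions supported in $\Omega_s$ (\<open>polarize_vanishes_off_annulus\<close>) and preserves the $L^2$ norm.
Since the logarithmic kernel decreases with the distance, it does not decrease the energy, and it
increases the energy strictly if $u < u \circ \sigma$ and $u > u \circ \sigma$ both occur on sets of
positive measure in the left half-plane (\<open>polarization_increases_energy\<close>).

Take for $u$ a maximiser of the energy on $\Omega_t$. As $R < 1/2$, the kernel is positive, and so
$u$ can be chosen positive throughout $\Omega_t$ (\<open>tau1_variational\<close>). Both strictness conditions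
hold: to the left of the line, $u$ vanishes on the part of the old hole that is not in the new one,
where $u \circ \sigma$ is positive; and because the line lies to the right of the origin, near
the left end of the disc $u$ is positive while $\sigma$ maps out of the disc. Thus the polarized
function is a competitor on $\Omega_s$ with the same norm and larger energy.

The variational formula rests on compactness of the operator. Logarithmic potentials are
equi-Hoelder continuous (\<open>log_potential_Hoelder\<close>), so by Arzela--Ascoli the images of a maximising
sequence have a uniformly convergent subsequence; since almost maximisers are almost eigenfunctions
(\<open>residual_le\<close>), the sequence itself then converges in $L^2$ to an eigenfunction
(\<open>top_eigenfunction_exists\<close>). All estimates of the kernel are reduced to
the local integrability of $1/|x|$ in the plane (\<open>nn_integral_inverse_distance_le\<close>).
\<close>

section \<open>Square-integrable functions\<close>

definition square_integrable :: "'a measure \<Rightarrow> ('a \<Rightarrow> real) set" where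
  "square_integrable M = {u \<in> borel_measurable M. integrable M (\<lambda>x. (u x)\<^sup>2)}"

lemma square_integrable_measurable:
  "u \<in> square_integrable M \<Longrightarrow> u \<in> borel_measurable M"
  by (simp add: square_integrable_def)

lemma square_integrable_power2:
  "u \<in> square_integrable M \<Longrightarrow> integrable M (\<lambda>x. (u x)\<^sup>2)"
  by (simp add: square_integrable_def)

lemma square_integrable_mult:
  assumes "u \<in> square_integrable M" "v \<in> square_integrable M"
  shows "integrable M (\<lambda>x. u x * v x)"
proof (rule Bochner_Integration.integrable_bound)
  show "integrable M (\<lambda>x. (u x)\<^sup>2 + (v x)\<^sup>2)"
    using assms by (simp add: square_integrable_def)
  show "(\<lambda>x. u x * v x) \<in> borel_measurable M"
    by (intro borel_measurable_times square_integrable_measurable assms)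
  have "\<bar>a * b\<bar> \<le> a\<^sup>2 + b\<^sup>2" for a b :: real
  proof -
    have "2 * \<bar>a * b\<bar> \<le> a\<^sup>2 + b\<^sup>2"
      using sum_squares_bound[of "\<bar>a\<bar>" "\<bar>b\<bar>"] by (simp add: abs_mult mult.assoc)
    then show ?thesis by (smt (verit) abs_ge_zero)
  qed
  then show "AE x in M. norm (u x * v x) \<le> norm ((u x)\<^sup>2 + (v x)\<^sup>2)"
    by (simp add: abs_of_nonneg)
qed

lemma square_integrable_lincomb:
  assumes u: "u \<in> square_integrable M" and v: "v \<in> square_integrable M"
  shows "(\<lambda>x. a * u x + b * v x) \<in> square_integrable M"
    and "(\<integral>x. (a * u x + b * v x)\<^sup>2 \<partial>M) =
      a\<^sup>2 * (\<integral>x. (u x)\<^sup>2 \<partial>M) + 2 * a * b * (\<integral>x. u x * v x \<partial>M) + b\<^sup>2 * (\<integral>x. (v x)\<^sup>2 \<partial>M)"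
proof -
  note [simp] = square_integrable_mult[OF u v] square_integrable_power2[OF u] square_integrable_power2[OF v]
  have *: "(\<lambda>x. (a * u x + b * v x)\<^sup>2) =
      (\<lambda>x. a\<^sup>2 * (u x)\<^sup>2 + (2 * a * b) * (u x * v x) + b\<^sup>2 * (v x)\<^sup>2)"
    by (auto simp: power2_eq_square algebra_simps)
  show "(\<lambda>x. a * u x + b * v x) \<in> square_integrable M"
    using u v by (simp add: square_integrable_def) (simp add: *)
  show "(\<integral>x. (a * u x + b * v x)\<^sup>2 \<partial>M) =
      a\<^sup>2 * (\<integral>x. (u x)\<^sup>2 \<partial>M) + 2 * a * b * (\<integral>x. u x * v x \<partial>M) + b\<^sup>2 * (\<integral>x. (v x)\<^sup>2 \<partial>M)"
    by (simp add: *)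
qed

lemma square_sum_le:
  fixes p q :: real shows "(p + q)\<^sup>2 \<le> 2 * p\<^sup>2 + 2 * q\<^sup>2"
  using sum_squares_bound[of p q] by (simp add: power2_sum)

lemma square_integrable_abs:
  "u \<in> square_integrable M \<Longrightarrow> (\<lambda>x. \<bar>u x\<bar>) \<in> square_integrable M"
  unfolding square_integrable_def by (simp add: borel_measurable_abs)

text \<open>The quadratic form of the Gram matrix of \<^term>\<open>u\<close> and \<^term>\<open>v\<close> is nonnegative.
Evaluating it near its minimum gives the inequality.\<close>

lemma integral_Cauchy_Schwarz:
  assumes u: "u \<in> square_integrable M" and v: "v \<in> square_integrable M"
  shows "(\<integral>x. u x * v x \<partial>M)\<^sup>2 \<le> (\<integral>x. (u x)\<^sup>2 \<partial>M) * (\<integral>x. (v x)\<^sup>2 \<partial>M)"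
proof -
  define A where "A = (\<integral>x. (u x)\<^sup>2 \<partial>M)"
  define B where "B = (\<integral>x. (v x)\<^sup>2 \<partial>M)"
  define c where "c = (\<integral>x. u x * v x \<partial>M)"
  have q: "0 \<le> a\<^sup>2 * A + 2 * a * b * c + b\<^sup>2 * B" for a b
    using square_integrable_lincomb(2)[OF u v, of a b]
      Bochner_Integration.integral_nonneg[of M "\<lambda>x. (a * u x + b * v x)\<^sup>2"]
    by (simp add: A_def B_def c_def)
  have "0 \<le> B" by (simp add: B_def)
  show ?thesis unfolding A_def[symmetric] B_def[symmetric] c_def[symmetric]
  proof (cases "B = 0")
    case False
    \<comment> \<open>For fixed $a$ the form is minimal at $b = -ac/B$.\<close>
    have "0 \<le> B * (A * B - c\<^sup>2)"
      using q[of B "- c"] by (simp add: power2_eq_square algebra_simps)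
    with False \<open>0 \<le> B\<close> show "c\<^sup>2 \<le> A * B"
      by (simp add: zero_le_mult_iff)
  next
    case True
    \<comment> \<open>If $B = 0$, the form is affine in $b$, so a nonzero slope would make it negative somewhere.\<close>
    have "c = 0"
    proof (rule ccontr)
      assume "c \<noteq> 0"
      then show False using q[of 1 "- (A + 1) / (2 * c)"] True by (simp add: field_simps)
    qed
    with True show "c\<^sup>2 \<le> A * B" by simp
  qed
qed

lemma (in finite_measure) bounded_imp_square_integrable:
  assumes "u \<in> borel_measurable M" "\<And>x. x \<in> space M \<Longrightarrow> \<bar>u x\<bar> \<le> B"
  shows "u \<in> square_integrable M"
proof -
  have "integrable M (\<lambda>x. (u x)\<^sup>2)"
  proof (rule integrable_const_bound[of _ "B\<^sup>2"])
    show "AE x in M. norm ((u x)\<^sup>2) \<le> B\<^sup>2"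
      using power_mono[OF assms(2) abs_ge_zero, of _ 2] by (intro AE_I2) simp
  qed (use assms(1) in simp)
  then show ?thesis using assms(1) by (simp add: square_integrable_def)
qed

section \<open>Integral operators with a symmetric kernel\<close>

text \<open>The uniform bound \<^term>\<open>C\<close> on the rows says that the integral operator maps $L^2$ into
bounded functions. With a finite measure this makes it bounded on $L^2$, and, more importantly,
lets convergence in $L^2$ be turned into pointwise convergence of the images.\<close>

locale symmetric_kernel = finite_measure M
  for M :: "'a measure" +
  fixes K :: "'a \<Rightarrow> 'a \<Rightarrow> real" and C :: real
  assumes K_measurable: "(\<lambda>p. K (fst p) (snd p)) \<in> borel_measurable (M \<Otimes>\<^sub>M M)"
    and K_sym: "\<lbrakk>x \<in> space M; y \<in> space M\<rbrakk> \<Longrightarrow> K x y = K y x"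
    and K_row: "x \<in> space M \<Longrightarrow> K x \<in> square_integrable M"
    and K_bound: "x \<in> space M \<Longrightarrow> (\<integral>y. (K x y)\<^sup>2 \<partial>M) \<le> C"
    and C_nonneg: "0 \<le> C"
begin

abbreviation L2 where "L2 \<equiv> square_integrable M"

definition norm2 :: "('a \<Rightarrow> real) \<Rightarrow> real" where
  "norm2 u = (\<integral>x. (u x)\<^sup>2 \<partial>M)"

definition T :: "('a \<Rightarrow> real) \<Rightarrow> 'a \<Rightarrow> real" where
  "T u x = (\<integral>y. K x y * u y \<partial>M)"

definition E :: "('a \<Rightarrow> real) \<Rightarrow> real" where
  "E u = (\<integral>x. u x * T u x \<partial>M)"

lemma norm2_nonneg: "0 \<le> norm2 u"
  by (simp add: norm2_def)

lemma T_square_le: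
  assumes "u \<in> L2" "x \<in> space M"
  shows "(T u x)\<^sup>2 \<le> C * norm2 u"
proof -
  have "(T u x)\<^sup>2 \<le> (\<integral>y. (K x y)\<^sup>2 \<partial>M) * norm2 u"
    unfolding T_def norm2_def
    by (rule integral_Cauchy_Schwarz) (use assms K_row in auto)
  also have "\<dots> \<le> C * norm2 u"
    by (rule mult_right_mono[OF K_bound[OF assms(2)] norm2_nonneg])
  finally show ?thesis .
qed

lemma T_abs_le:
  assumes "u \<in> L2" "x \<in> space M"
  shows "\<bar>T u x\<bar> \<le> sqrt (C * norm2 u)"
  using real_sqrt_le_mono[OF T_square_le[OF assms]] by simp

lemma T_L2:
  assumes "u \<in> L2" shows "T u \<in> L2"
proof (rule bounded_imp_square_integrable)
  have [measurable]: "u \<in> borel_measurable M"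
    using assms by (rule square_integrable_measurable)
  have [measurable]: "(\<lambda>(x, y). K x y) \<in> borel_measurable (M \<Otimes>\<^sub>M M)"
    using K_measurable by (simp add: case_prod_unfold)
  show "T u \<in> borel_measurable M"
    unfolding T_def by measurable
qed (rule T_abs_le[OF assms])

lemma T_lincomb:
  assumes "u \<in> L2" "v \<in> L2" "x \<in> space M"
  shows "T (\<lambda>y. a * u y + b * v y) x = a * T u x + b * T v x"
proof -
  have "T (\<lambda>y. a * u y + b * v y) x = (\<integral>y. a * (K x y * u y) + b * (K x y * v y) \<partial>M)"
    unfolding T_def by (rule Bochner_Integration.integral_cong) (auto simp: algebra_simps)
  also have "\<dots> = a * T u x + b * T v x"
    using assms K_row by (simp add: T_def square_integrable_mult)
  finally show ?thesis .
qed

lemma norm2_T_le: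
  assumes "u \<in> L2" shows "norm2 (T u) \<le> C * measure M (space M) * norm2 u"
proof -
  have "norm2 (T u) \<le> (\<integral>x. C * norm2 u \<partial>M)"
    unfolding norm2_def[of "T u"]
    by (rule integral_mono) (use T_square_le[OF assms] square_integrable_power2[OF T_L2[OF assms]] in auto)
  then show ?thesis by (simp add: algebra_simps)
qed

text \<open>This is Fubini's theorem. The double integral converges absolutely because
the rows of $|K|$ obey the same bound.\<close>

lemma T_symmetric:
  assumes u: "u \<in> L2" and v: "v \<in> L2"
  shows "(\<integral>x. u x * T v x \<partial>M) = (\<integral>x. v x * T u x \<partial>M)"
proof -
  interpret P: pair_sigma_finite M M ..
  have [measurable]: "u \<in> borel_measurable M" "v \<in> borel_measurable M"
    using u v by (auto simp: square_integrable_def)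
  have [measurable]: "(\<lambda>(x, y). K x y) \<in> borel_measurable (M \<Otimes>\<^sub>M M)"
    using K_measurable by (simp add: case_prod_unfold)
  let ?f = "\<lambda>(x, y). u x * (K x y * v y)"
  have int: "integrable (M \<Otimes>\<^sub>M M) ?f"
  proof (rule P.Fubini_integrable)
    show "?f \<in> borel_measurable (M \<Otimes>\<^sub>M M)" by measurable
    have rows: "integrable M (\<lambda>y. \<bar>K x y\<bar> * \<bar>v y\<bar>)" if "x \<in> space M" for x
      by (rule square_integrable_mult)
        (use K_row[OF that] v in \<open>auto intro: square_integrable_abs\<close>)
    show "AE x in M. integrable M (\<lambda>y. ?f (x, y))"
      using K_row v by (auto intro!: AE_I2 integrable_mult_right square_integrable_mult)
    have le: "\<bar>(\<integral>y. \<bar>K x y\<bar> * \<bar>v y\<bar> \<partial>M)\<bar> \<le> sqrt (C * norm2 v)" if x: "x \<in> space M" for x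
    proof -
      have "(\<integral>y. \<bar>K x y\<bar> * \<bar>v y\<bar> \<partial>M)\<^sup>2 \<le> (\<integral>y. \<bar>K x y\<bar>\<^sup>2 \<partial>M) * (\<integral>y. \<bar>v y\<bar>\<^sup>2 \<partial>M)"
        by (rule integral_Cauchy_Schwarz) (use K_row[OF x] v in \<open>auto intro: square_integrable_abs\<close>)
      also have "\<dots> \<le> C * norm2 v"
        using mult_right_mono[OF K_bound[OF x] norm2_nonneg[of v]] by (simp add: norm2_def)
      finally show ?thesis
        using real_sqrt_le_mono by fastforce
    qed
    have "integrable M (\<lambda>x. \<bar>u x\<bar> * (\<integral>y. \<bar>K x y\<bar> * \<bar>v y\<bar> \<partial>M))"
      by (rule square_integrable_mult, rule square_integrable_abs[OF u],
          rule bounded_imp_square_integrable[OF _ le]) measurable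
    then show "integrable M (\<lambda>x. \<integral>y. norm (?f (x, y)) \<partial>M)"
      by (simp add: abs_mult)
  qed
  have "(\<integral>x. u x * T v x \<partial>M) = (\<integral>x. \<integral>y. ?f (x, y) \<partial>M \<partial>M)"
    by (simp add: T_def)
  also have "\<dots> = (\<integral>y. \<integral>x. ?f (x, y) \<partial>M \<partial>M)"
    by (rule P.Fubini_integral[symmetric]) (use int in \<open>simp add: case_prod_unfold\<close>)
  also have "\<dots> = (\<integral>y. v y * T u y \<partial>M)"
    unfolding T_def
  proof (rule Bochner_Integration.integral_cong[OF refl])
    fix y assume y: "y \<in> space M"
    have "(\<integral>x. ?f (x, y) \<partial>M) = (\<integral>x. v y * (K y x * u x) \<partial>M)"
      by (rule Bochner_Integration.integral_cong) (auto simp: K_sym[OF _ y])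
    then show "(\<integral>x. ?f (x, y) \<partial>M) = v y * (\<integral>x. K y x * u x \<partial>M)" by simp
  qed
  finally show ?thesis .
qed

lemma E_abs_le:
  assumes "u \<in> L2"
  shows "\<bar>E u\<bar> \<le> sqrt (C * measure M (space M)) * norm2 u"
proof -
  have "(E u)\<^sup>2 \<le> norm2 u * norm2 (T u)"
    unfolding E_def norm2_def by (rule integral_Cauchy_Schwarz[OF assms T_L2[OF assms]])
  also have "\<dots> \<le> norm2 u * (C * measure M (space M) * norm2 u)"
    by (rule mult_left_mono[OF norm2_T_le[OF assms] norm2_nonneg])
  finally have "sqrt ((E u)\<^sup>2) \<le> sqrt ((C * measure M (space M)) * (norm2 u)\<^sup>2)"
    by (intro real_sqrt_le_mono) (simp add: power2_eq_square algebra_simps)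
  then show ?thesis by (simp add: real_sqrt_mult norm2_nonneg)
qed

lemma E_lincomb:
  assumes u: "u \<in> L2" and v: "v \<in> L2"
  shows "E (\<lambda>x. a * u x + b * v x) = a\<^sup>2 * E u + 2 * a * b * (\<integral>x. v x * T u x \<partial>M) + b\<^sup>2 * E v"
proof -
  note [simp] = square_integrable_mult[OF _ T_L2, OF u u] square_integrable_mult[OF _ T_L2, OF u v]
    square_integrable_mult[OF _ T_L2, OF v v] square_integrable_mult[OF _ T_L2, OF v u]
  have "E (\<lambda>x. a * u x + b * v x) =
      (\<integral>x. a\<^sup>2 * (u x * T u x) + a * b * (v x * T u x) + a * b * (u x * T v x) + b\<^sup>2 * (v x * T v x) \<partial>M)"
    unfolding E_def
    by (rule Bochner_Integration.integral_cong)
      (auto simp: T_lincomb[OF u v] power2_eq_square algebra_simps)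
  also have "\<dots> = a\<^sup>2 * E u + 2 * a * b * (\<integral>x. v x * T u x \<partial>M) + b\<^sup>2 * E v"
    using T_symmetric[OF u v] by (simp add: E_def)
  finally show ?thesis .
qed

text \<open>For a nonnegative kernel a maximising sequence of \<^term>\<open>E\<close> may thus be taken nonnegative.\<close>

lemma E_le_E_abs:
  assumes u: "u \<in> L2" and K: "\<And>x y. \<lbrakk>x \<in> space M; y \<in> space M\<rbrakk> \<Longrightarrow> 0 \<le> K x y"
  shows "E u \<le> E (\<lambda>x. \<bar>u x\<bar>)"
  unfolding E_def
proof (rule integral_mono)
  show "integrable M (\<lambda>x. u x * T u x)"
    by (rule square_integrable_mult[OF u T_L2[OF u]])
  show "integrable M (\<lambda>x. \<bar>u x\<bar> * T (\<lambda>x. \<bar>u x\<bar>) x)"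
    by (intro square_integrable_mult T_L2 square_integrable_abs u)
  fix x assume x: "x \<in> space M"
  have "\<bar>T u x\<bar> \<le> (\<integral>y. \<bar>K x y * u y\<bar> \<partial>M)"
    unfolding T_def by (rule integral_abs_bound)
  also have "\<dots> = T (\<lambda>x. \<bar>u x\<bar>) x"
    unfolding T_def by (rule Bochner_Integration.integral_cong) (auto simp: abs_mult K[OF x])
  finally have "\<bar>u x\<bar> * \<bar>T u x\<bar> \<le> \<bar>u x\<bar> * T (\<lambda>x. \<bar>u x\<bar>) x"
    by (rule mult_left_mono) simp
  then show "u x * T u x \<le> \<bar>u x\<bar> * T (\<lambda>x. \<bar>u x\<bar>) x"
    by (metis abs_ge_self abs_mult order_trans)
qed

text \<open>An almost maximiser is an almost eigenfunction. The form $Q(w) = S\|w\|^2 - E(w)$ is positive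
semidefinite and bounded by $c\|w\|^2$, and the residual $v = Su - Tu$ represents
the linear form $Q(u, \cdot)$. Hence a step $h$ along $-v$ lowers $Q$ from $Q(u)$ at
the initial rate $2\|v\|^2$. As $Q$ stays nonnegative, $\|v\|^2$ is small if $Q(u)$ is.\<close>

lemma residual_le:
  assumes S: "\<And>w. w \<in> L2 \<Longrightarrow> E w \<le> S * norm2 w" and "0 \<le> S"
    and u: "u \<in> L2"
  defines "c \<equiv> S + sqrt (C * measure M (space M)) + 1"
  shows "norm2 (\<lambda>x. S * u x - T u x) \<le> c * (S * norm2 u - E u)"
proof -
  define v where "v = (\<lambda>x. S * u x + (- 1) * T u x)"
  have v: "v \<in> L2"
    unfolding v_def by (rule square_integrable_lincomb(1)[OF u T_L2[OF u]])
  have c: "0 < c" using \<open>0 \<le> S\<close> C_nonneg by (simp add: c_def add_nonneg_pos)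
  have "norm2 v = (\<integral>x. S * (v x * u x) - v x * T u x \<partial>M)"
    unfolding norm2_def
    by (rule Bochner_Integration.integral_cong) (auto simp: v_def power2_eq_square algebra_simps)
  also have "\<dots> = S * (\<integral>x. v x * u x \<partial>M) - (\<integral>x. v x * T u x \<partial>M)"
    by (simp add: square_integrable_mult[OF v u] square_integrable_mult[OF v T_L2[OF u]])
  finally have cross: "S * (\<integral>x. u x * v x \<partial>M) - (\<integral>x. v x * T u x \<partial>M) = norm2 v"
    by (simp add: mult.commute)
  \<comment> \<open>The step length $1/c$ minimises the upper bound $Q(u) - 2h\|v\|^2 + h^2c\|v\|^2$.\<close>
  have "0 \<le> S * norm2 (\<lambda>x. 1 * u x + (- 1 / c) * v x) - E (\<lambda>x. 1 * u x + (- 1 / c) * v x)"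
    using S[OF square_integrable_lincomb(1)[OF u v, of 1 "- 1 / c"]] by simp
  also have "\<dots> = S * norm2 u - E u - 2 / c * (S * (\<integral>x. u x * v x \<partial>M) - (\<integral>x. v x * T u x \<partial>M))
      + (S * norm2 v - E v) / c\<^sup>2"
    unfolding E_lincomb[OF u v] norm2_def square_integrable_lincomb(2)[OF u v]
    using c by (simp add: field_simps power2_eq_square)
  also have "\<dots> = S * norm2 u - E u - 2 / c * norm2 v + (S * norm2 v - E v) / c\<^sup>2"
    by (simp only: cross)
  also have "\<dots> \<le> S * norm2 u - E u - 2 / c * norm2 v + (c * norm2 v) / c\<^sup>2"
  proof -
    have "S * norm2 v - E v \<le> c * norm2 v"
      using E_abs_le[OF v] norm2_nonneg[of v] by (simp add: c_def algebra_simps)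
    then show ?thesis using c by (simp add: divide_right_mono)
  qed
  also have "\<dots> = S * norm2 u - E u - norm2 v / c"
    using c by (simp add: field_simps power2_eq_square)
  finally show ?thesis using c by (simp add: v_def field_simps)
qed

text \<open>The direct method, arranged so that neither completeness of $L^2$ nor weak compactness is needed.
For a maximising sequence $V_n$ the residual $S V_n - T V_n$ tends to $0$ in $L^2$. Along a
subsequence $T V_n$ converges uniformly to some $g$, so $V_n$ itself converges
in $L^2$ to $g/S$. The images then converge pointwise to $T(g/S)$,
whence $T(g/S) = g$.\<close>

theorem top_eigenfunction_exists:
  assumes K_nonneg: "\<And>x y. \<lbrakk>x \<in> space M; y \<in> space M\<rbrakk> \<Longrightarrow> 0 \<le> K x y"
    and E_somewhere_pos: "\<exists>u \<in> L2. 0 < E u"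
    and compact: "\<And>u :: nat \<Rightarrow> 'a \<Rightarrow> real. (\<And>n. u n \<in> L2 \<and> norm2 (u n) \<le> 1) \<Longrightarrow>
      \<exists>g r. strict_mono (r :: nat \<Rightarrow> nat) \<and>
        (\<forall>e>0. \<exists>N. \<forall>n\<ge>N. \<forall>x \<in> space M. \<bar>T (u (r n)) x - g x\<bar> \<le> e)"
  obtains S u where "0 < S" "u \<in> L2" "0 < norm2 u"
    "\<And>x. x \<in> space M \<Longrightarrow> 0 \<le> u x" "\<And>x. x \<in> space M \<Longrightarrow> T u x = S * u x"
    "\<And>w. w \<in> L2 \<Longrightarrow> E w \<le> S * norm2 w"
proof -
  define D where "D = {u \<in> L2. norm2 u \<le> 1}"
  define S where "S = (SUP u\<in>D. E u)"
  have E_scale: "E (\<lambda>x. a * w x) = a\<^sup>2 * E w" "norm2 (\<lambda>x. a * w x) = a\<^sup>2 * norm2 w"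
    "(\<lambda>x. a * w x) \<in> L2" if "w \<in> L2" for a w
    using E_lincomb[OF that that, of a 0] square_integrable_lincomb[OF that that, of a 0]
    by (simp_all add: norm2_def)
  have bdd: "bdd_above (E ` D)"
  proof (rule bdd_aboveI2)
    fix u assume "u \<in> D"
    then have "\<bar>E u\<bar> \<le> sqrt (C * measure M (space M)) * norm2 u" "norm2 u \<le> 1"
      using E_abs_le by (auto simp: D_def)
    then show "E u \<le> sqrt (C * measure M (space M))"
      using mult_left_mono[of "norm2 u" 1 "sqrt (C * measure M (space M))"] C_nonneg by simp
  qed
  have S_upper: "E w \<le> S * norm2 w" if w: "w \<in> L2" for w
  proof (cases "norm2 w = 0")
    case True
    then show ?thesis using E_abs_le[OF w] by simp
  next
    case False
    then have pos: "0 < norm2 w" using norm2_nonneg[of w] by simp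
    define a where "a = 1 / sqrt (norm2 w)"
    have a: "a\<^sup>2 = 1 / norm2 w" using pos by (simp add: a_def power_divide)
    have "(\<lambda>x. a * w x) \<in> D" using E_scale[OF w, of a] a pos by (simp add: D_def)
    then have "E (\<lambda>x. a * w x) \<le> S" unfolding S_def by (rule cSUP_upper[OF _ bdd])
    then show ?thesis using pos by (simp add: E_scale[OF w] a field_simps)
  qed
  have S_pos: "0 < S"
  proof -
    obtain w where w: "w \<in> L2" "0 < E w" using E_somewhere_pos by blast
    have "0 < S * norm2 w" using S_upper[OF w(1)] w(2) by linarith
    then show ?thesis using norm2_nonneg[of w] by (simp add: zero_less_mult_iff)
  qed
  have "\<exists>w \<in> D. (\<forall>x. 0 \<le> w x) \<and> S - 1 / real (Suc n) < E w" for n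
  proof -
    have "S - 1 / real (Suc n) < S" by simp
    moreover have "D \<noteq> {}"
    proof -
      have "(\<lambda>_. 0) \<in> D" by (simp add: D_def square_integrable_def norm2_def)
      then show ?thesis by blast
    qed
    ultimately obtain w where w: "w \<in> D" "S - 1 / real (Suc n) < E w"
      using less_cSUP_iff[OF _ bdd] unfolding S_def by blast
    then have "(\<lambda>x. \<bar>w x\<bar>) \<in> D" by (simp add: D_def norm2_def square_integrable_abs)
    moreover have "E w \<le> E (\<lambda>x. \<bar>w x\<bar>)"
      using w(1) K_nonneg by (intro E_le_E_abs) (auto simp: D_def)
    ultimately show ?thesis using w(2) by (intro bexI[of _ "\<lambda>x. \<bar>w x\<bar>"]) auto
  qed
  then obtain U where U: "\<And>n. U n \<in> D" "\<And>n x. 0 \<le> U n x" "\<And>n. S - 1 / real (Suc n) < E (U n)"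
    by metis
  obtain g r where r: "strict_mono (r :: nat \<Rightarrow> nat)"
    and g: "\<And>e. e > 0 \<Longrightarrow> \<exists>N. \<forall>n\<ge>N. \<forall>x \<in> space M. \<bar>T (U (r n)) x - g x\<bar> \<le> e"
    using compact[of U] U(1) unfolding D_def by blast
  define V where "V n = U (r n)" for n
  have V_L2: "V n \<in> L2" and V_norm: "norm2 (V n) \<le> 1" and V_nonneg: "0 \<le> V n x" for n x
    using U by (auto simp: V_def D_def)
  have TV_lim: "(\<lambda>n. T (V n) x) \<longlonglongrightarrow> g x" if "x \<in> space M" for x
  proof (rule LIMSEQ_I)
    fix e :: real assume "0 < e"
    then obtain N where "\<forall>n\<ge>N. \<forall>x \<in> space M. \<bar>T (V n) x - g x\<bar> \<le> e / 2"
      using g[of "e / 2"] by (auto simp: V_def)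
    then show "\<exists>N. \<forall>n\<ge>N. norm (T (V n) x - g x) < e"
      using that \<open>0 < e\<close> by (intro exI[of _ N]) force
  qed
  have T_meas [measurable]: "T (V n) \<in> borel_measurable M" for n
    using T_L2[OF V_L2] by (rule square_integrable_measurable)
  have g_meas: "g \<in> borel_measurable M"
    by (rule borel_measurable_LIMSEQ_real[OF TV_lim T_meas])
  have g_L2: "g \<in> L2"
  proof (rule bounded_imp_square_integrable[OF g_meas])
    fix x assume x: "x \<in> space M"
    have "\<bar>T (V n) x\<bar> \<le> sqrt C" for n
    proof -
      have "\<bar>T (V n) x\<bar> \<le> sqrt (C * norm2 (V n))" by (rule T_abs_le[OF V_L2 x])
      also have "\<dots> \<le> sqrt C"
        using mult_left_mono[OF V_norm C_nonneg] by simp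
      finally show ?thesis .
    qed
    then show "\<bar>g x\<bar> \<le> sqrt C"
      by (intro LIMSEQ_le_const2[OF tendsto_rabs[OF TV_lim[OF x]]]) auto
  qed
  define u where "u = (\<lambda>x. (1 / S) * g x)"
  have u_L2: "u \<in> L2" unfolding u_def by (rule E_scale(3)[OF g_L2])
  have EV_lim: "(\<lambda>n. E (V n)) \<longlonglongrightarrow> S"
  proof (rule tendsto_sandwich)
    show "(\<lambda>n. S - 1 / real (Suc n)) \<longlonglongrightarrow> S"
      using tendsto_diff[OF tendsto_const LIMSEQ_inverse_real_of_nat, of S]
      by (simp add: inverse_eq_divide)
    show "\<forall>\<^sub>F n in sequentially. S - 1 / real (Suc n) \<le> E (V n)"
    proof (rule always_eventually, rule allI)
      fix n
      have "n \<le> r n" using r by (rule seq_suble)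
      then have "1 / real (Suc (r n)) \<le> 1 / real (Suc n)" by (intro divide_left_mono) auto
      then show "S - 1 / real (Suc n) \<le> E (V n)" using U(3)[of "r n"] by (simp add: V_def)
    qed
    show "\<forall>\<^sub>F n in sequentially. E (V n) \<le> S"
      using U(1) by (auto simp: V_def S_def intro!: always_eventually cSUP_upper[OF _ bdd])
  qed simp
  \<comment> \<open>Strong convergence of the maximising sequence, from the residual and the uniform limit.\<close>
  have V_lim: "(\<lambda>n. norm2 (\<lambda>x. V n x - u x)) \<longlonglongrightarrow> 0"
  proof -
    define c where "c = S + sqrt (C * measure M (space M)) + 1"
    define m where "m = measure M (space M)"
    have c: "0 < c" using S_pos C_nonneg by (simp add: c_def add_nonneg_pos)
    have split: "S\<^sup>2 * norm2 (\<lambda>x. V n x - u x) \<le>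
        2 * (c * (S - E (V n))) + 2 * norm2 (\<lambda>x. T (V n) x - g x)" for n
    proof -
      have R: "(\<lambda>x. S * V n x - T (V n) x) \<in> L2" "(\<lambda>x. T (V n) x - g x) \<in> L2"
        using square_integrable_lincomb(1)[OF V_L2 T_L2[OF V_L2], of S n "-1" n]
          square_integrable_lincomb(1)[OF T_L2[OF V_L2] g_L2, of 1 n "-1"] by simp_all
      have "(\<lambda>x. 1 * V n x + (-1) * u x) \<in> L2"
        by (rule square_integrable_lincomb(1)[OF V_L2 u_L2])
      then have Vu: "integrable M (\<lambda>x. S\<^sup>2 * (V n x - u x)\<^sup>2)"
        by (simp add: square_integrable_def)
      have "S\<^sup>2 * norm2 (\<lambda>x. V n x - u x) = (\<integral>x. S\<^sup>2 * (V n x - u x)\<^sup>2 \<partial>M)"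
        by (simp add: norm2_def)
      also have "\<dots> \<le> (\<integral>x. 2 * (S * V n x - T (V n) x)\<^sup>2 + 2 * (T (V n) x - g x)\<^sup>2 \<partial>M)"
      proof (rule integral_mono[OF Vu])
        show "integrable M (\<lambda>x. 2 * (S * V n x - T (V n) x)\<^sup>2 + 2 * (T (V n) x - g x)\<^sup>2)"
          using R by (simp add: square_integrable_def)
        fix x
        have "S\<^sup>2 * (V n x - u x)\<^sup>2 = ((S * V n x - T (V n) x) + (T (V n) x - g x))\<^sup>2"
          using S_pos by (simp add: u_def power_mult_distrib[symmetric] right_diff_distrib)
        also have "\<dots> \<le> 2 * (S * V n x - T (V n) x)\<^sup>2 + 2 * (T (V n) x - g x)\<^sup>2"
          by (rule square_sum_le)
        finally show "S\<^sup>2 * (V n x - u x)\<^sup>2 \<le>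
            2 * (S * V n x - T (V n) x)\<^sup>2 + 2 * (T (V n) x - g x)\<^sup>2" .
      qed
      also have "\<dots> = 2 * norm2 (\<lambda>x. S * V n x - T (V n) x) + 2 * norm2 (\<lambda>x. T (V n) x - g x)"
        using R by (simp add: square_integrable_def norm2_def)
      also have "norm2 (\<lambda>x. S * V n x - T (V n) x) \<le> c * (S - E (V n))"
      proof -
        have "norm2 (\<lambda>x. S * V n x - T (V n) x) \<le> c * (S * norm2 (V n) - E (V n))"
          unfolding c_def by (rule residual_le[OF S_upper _ V_L2]) (use S_pos in auto)
        also have "\<dots> \<le> c * (S - E (V n))"
          using c S_pos mult_left_mono[OF V_norm[of n], of S] by simp
        finally show ?thesis .
      qed
      finally show ?thesis by simp
    qed
    have unif: "(\<lambda>n. norm2 (\<lambda>x. T (V n) x - g x)) \<longlonglongrightarrow> 0"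
    proof (rule LIMSEQ_I)
      fix e :: real assume e: "0 < e"
      define d where "d = sqrt (e / (2 * (m + 1)))"
      have m: "0 \<le> m" by (simp add: m_def)
      have d: "0 < d" "d\<^sup>2 = e / (2 * (m + 1))" using e m by (auto simp: d_def)
      obtain N where N: "\<And>n x. n \<ge> N \<Longrightarrow> x \<in> space M \<Longrightarrow> \<bar>T (V n) x - g x\<bar> \<le> d"
        using g[OF d(1)] by (auto simp: V_def)
      have "norm2 (\<lambda>x. T (V n) x - g x) < e" if n: "n \<ge> N" for n
      proof -
        have "(\<lambda>x. 1 * T (V n) x + (-1) * g x) \<in> L2"
          by (rule square_integrable_lincomb(1)[OF T_L2[OF V_L2] g_L2])
        then have "norm2 (\<lambda>x. T (V n) x - g x) \<le> (\<integral>x. d\<^sup>2 \<partial>M)"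
          unfolding norm2_def
        proof (intro integral_mono)
          fix x assume x: "x \<in> space M"
          show "(T (V n) x - g x)\<^sup>2 \<le> d\<^sup>2"
            using N[OF n x] d(1) by (metis abs_le_square_iff abs_of_pos)
        qed (auto simp: square_integrable_def)
        also have "\<dots> = m * (e / (2 * (m + 1)))" by (simp add: m_def d)
        also have "\<dots> < e"
        proof -
          have "m * e < (2 * (m + 1)) * e" by (rule mult_strict_right_mono) (use e m in auto)
          then show ?thesis using m by (simp add: divide_less_eq mult.commute)
        qed
        finally show ?thesis .
      qed
      then show "\<exists>N. \<forall>n\<ge>N. norm (norm2 (\<lambda>x. T (V n) x - g x) - 0) < e"
        using norm2_nonneg by (intro exI[of _ N]) simp
    qed
    have "(\<lambda>n. 2 * (c * (S - E (V n))) + 2 * norm2 (\<lambda>x. T (V n) x - g x))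
        \<longlonglongrightarrow> 2 * (c * (S - S)) + 2 * 0"
      by (intro tendsto_intros EV_lim unif)
    then have upper: "(\<lambda>n. 2 * (c * (S - E (V n))) + 2 * norm2 (\<lambda>x. T (V n) x - g x)) \<longlonglongrightarrow> 0"
      by simp
    have "(\<lambda>n. S\<^sup>2 * norm2 (\<lambda>x. V n x - u x)) \<longlonglongrightarrow> 0"
    proof (rule tendsto_sandwich[OF _ _ tendsto_const upper])
      show "\<forall>\<^sub>F n in sequentially. 0 \<le> S\<^sup>2 * norm2 (\<lambda>x. V n x - u x)"
        by (intro always_eventually allI mult_nonneg_nonneg norm2_nonneg) simp
      show "\<forall>\<^sub>F n in sequentially. S\<^sup>2 * norm2 (\<lambda>x. V n x - u x) \<le>
          2 * (c * (S - E (V n))) + 2 * norm2 (\<lambda>x. T (V n) x - g x)"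
        by (intro always_eventually allI split)
    qed
    from tendsto_mult_left[OF this, of "1 / S\<^sup>2"] show ?thesis
      using S_pos by simp
  qed
  have Tu: "T u x = S * u x" if x: "x \<in> space M" for x
  proof -
    have "(\<lambda>n. T (V n) x - T u x) \<longlonglongrightarrow> 0"
    proof (rule Lim_null_comparison)
      show "(\<lambda>n. sqrt (C * norm2 (\<lambda>x. V n x - u x))) \<longlonglongrightarrow> 0"
        using tendsto_real_sqrt[OF tendsto_mult_right[OF V_lim, of C]] by (simp add: mult.commute)
      have "\<bar>T (V n) x - T u x\<bar> \<le> sqrt (C * norm2 (\<lambda>x. V n x - u x))" for n
        using T_abs_le[OF square_integrable_lincomb(1)[OF V_L2 u_L2, of 1 n "-1"] x]
          T_lincomb[OF V_L2 u_L2 x, of 1 n "-1"] by simp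
      then show "\<forall>\<^sub>F n in sequentially. norm (T (V n) x - T u x) \<le> sqrt (C * norm2 (\<lambda>x. V n x - u x))"
        by simp
    qed
    then have "(\<lambda>n. T (V n) x) \<longlonglongrightarrow> T u x" by (simp add: LIM_zero_iff)
    then have "T u x = g x" by (rule LIMSEQ_unique[OF _ TV_lim[OF x]])
    then show ?thesis using S_pos by (simp add: u_def)
  qed
  have u_nonneg: "0 \<le> u x" if x: "x \<in> space M" for x
  proof -
    have "0 \<le> T (V n) x" for n
      unfolding T_def
      by (rule Bochner_Integration.integral_nonneg) (simp add: K_nonneg[OF x] V_nonneg)
    then have "0 \<le> g x" by (intro LIMSEQ_le_const[OF TV_lim[OF x]]) auto
    then show ?thesis using S_pos by (simp add: u_def)
  qed
  \<comment> \<open>If the limit vanished, $V_n$ would tend to $0$, and so would $E(V_n)$, whose limit is $S > 0$.\<close>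
  have "norm2 u \<noteq> 0"
  proof
    assume zero: "norm2 u = 0"
    have "E (V n) \<le> S * (2 * norm2 (\<lambda>x. V n x - u x))" for n
    proof -
      have d: "(\<lambda>x. V n x - u x) \<in> L2"
        using square_integrable_lincomb(1)[OF V_L2 u_L2, of 1 n "-1"] by simp
      have "norm2 (V n) \<le> (\<integral>x. 2 * (V n x - u x)\<^sup>2 + 2 * (u x)\<^sup>2 \<partial>M)"
        unfolding norm2_def
      proof (rule integral_mono)
        fix x
        show "(V n x)\<^sup>2 \<le> 2 * (V n x - u x)\<^sup>2 + 2 * (u x)\<^sup>2"
          using square_sum_le[of "V n x - u x" "u x"] by simp
      qed (use V_L2[of n] d u_L2 in \<open>auto simp: square_integrable_def\<close>)
      also have "\<dots> = 2 * norm2 (\<lambda>x. V n x - u x) + 2 * norm2 u"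
        using d u_L2 by (simp add: square_integrable_def norm2_def)
      finally have "norm2 (V n) \<le> 2 * norm2 (\<lambda>x. V n x - u x)" by (simp add: zero)
      then show ?thesis
        by (intro order_trans[OF S_upper[OF V_L2]] mult_left_mono) (use S_pos in auto)
    qed
    moreover have "(\<lambda>n. S * (2 * norm2 (\<lambda>x. V n x - u x))) \<longlonglongrightarrow> S * (2 * 0)"
      by (intro tendsto_intros V_lim)
    ultimately have "S \<le> S * (2 * 0)"
      by (intro LIMSEQ_le[OF EV_lim]) auto
    then show False using S_pos by simp
  qed
  then have "0 < norm2 u" using norm2_nonneg[of u] by simp
  from that[OF S_pos u_L2 this u_nonneg Tu S_upper] show thesis .
qed

end

section \<open>The logarithmic kernel and the variational formula for its largest eigenvalue\<close>

text \<open>Together with the next lemma this reduces all estimates for the logarithmic kernel to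
the local integrability of $1/|x - z|$ in the plane: the first bounds the kernel in $L^2$,
the second its modulus of continuity. Both come from $\ln s \le s - 1$ applied to a square root,
which halves the exponent of the singularity.\<close>

lemma ln_square_le:
  fixes a :: real
  assumes "0 < a" "a \<le> 1"
  shows "(ln a)\<^sup>2 \<le> 4 / a"
proof -
  have "ln (1 / sqrt a) \<le> 1 / sqrt a - 1"
    by (rule ln_le_minus_one) (use assms in simp)
  moreover have "ln (1 / sqrt a) = - ln a / 2"
    using assms by (simp add: ln_div ln_sqrt)
  ultimately have "- ln a \<le> 2 / sqrt a" by linarith
  moreover have "0 \<le> - ln a" using assms by simp
  ultimately have "(- ln a)\<^sup>2 \<le> (2 / sqrt a)\<^sup>2" by (intro power_mono)
  then show ?thesis using assms by (simp add: power_divide)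
qed

lemma ln_diff_square_le:
  fixes a b :: real
  assumes "0 < a" "0 < b"
  shows "(ln a - ln b)\<^sup>2 \<le> 4 * \<bar>a - b\<bar> * (1 / a + 1 / b)"
proof -
  have *: "(ln a - ln b)\<^sup>2 \<le> 4 * \<bar>a - b\<bar> * (1 / a + 1 / b)" if "0 < a" "a \<le> b" for a b :: real
  proof -
    have b: "0 < b" using that by simp
    have "ln (sqrt b / sqrt a) \<le> sqrt b / sqrt a - 1"
      by (rule ln_le_minus_one) (use that in simp)
    moreover have "ln (sqrt b / sqrt a) = (ln b - ln a) / 2"
      using that b by (simp add: ln_div ln_sqrt diff_divide_distrib)
    ultimately have "ln b - ln a \<le> 2 * (sqrt b - sqrt a) / sqrt a"
      using that by (simp add: field_simps)
    moreover have "0 \<le> ln b - ln a" using that by simp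
    ultimately have "(ln b - ln a)\<^sup>2 \<le> (2 * (sqrt b - sqrt a) / sqrt a)\<^sup>2" by (intro power_mono)
    also have "\<dots> = 4 * (sqrt b - sqrt a)\<^sup>2 / a"
      by (simp only: power_divide power_mult_distrib) (use that in simp)
    also have "(sqrt b - sqrt a)\<^sup>2 \<le> (sqrt b - sqrt a) * (sqrt b + sqrt a)"
      unfolding power2_eq_square by (rule mult_left_mono) (use that in auto)
    also have "\<dots> = b - a" using that b by (simp add: algebra_simps)
    finally have "(ln b - ln a)\<^sup>2 \<le> 4 * (b - a) * (1 / a)"
      using that by (simp add: divide_right_mono)
    also have "\<dots> \<le> 4 * (b - a) * (1 / a + 1 / b)"
      by (rule mult_left_mono) (use that b in auto)
    finally show ?thesis using that by (simp add: power2_commute)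
  qed
  show ?thesis
  proof (cases "a \<le> b")
    case True
    then show ?thesis using * assms by blast
  next
    case False
    then show ?thesis using *[of b a] assms by (simp add: power2_commute abs_minus_commute add.commute)
  qed
qed

text \<open>Dyadic decomposition around \<^term>\<open>x\<close>: where $2^{-k-1} \le |x - z| < 2^{-k}$ the integrand is at
most $2^{k+1}$, while the ball of radius $2^{-k}$ has area proportional to $4^{-k}$. The resulting
bound is the same for every centre.\<close>

lemma nn_integral_inverse_distance_le:
  fixes x :: "real^2"
  shows "(\<integral>\<^sup>+z. ennreal (1 / norm (x - z)) * indicator (ball x 1) z \<partial>lborel)
    \<le> ennreal (4 * measure lborel (ball (0 :: real^2) 1))"
proof -
  define c where "c = measure lborel (ball (0 :: real^2) 1)"
  have c: "0 \<le> c" by (simp add: c_def)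
  let ?g = "\<lambda>k z. ennreal (2 ^ Suc k) * indicator (ball x ((1/2) ^ k)) z"
  have "(\<integral>\<^sup>+z. ennreal (1 / norm (x - z)) * indicator (ball x 1) z \<partial>lborel)
      \<le> (\<integral>\<^sup>+z. (\<Sum>k. ?g k z) \<partial>lborel)"
  proof (rule nn_integral_mono)
    fix z
    show "ennreal (1 / norm (x - z)) * indicator (ball x 1) z \<le> (\<Sum>k. ?g k z)"
    proof (cases "z \<in> ball x 1 \<and> z \<noteq> x")
      case False
      \<comment> \<open>For $z = x$ this is the value $1/0 = 0$.\<close>
      then have "ennreal (1 / norm (x - z)) * indicator (ball x 1) z = 0" by auto
      then show ?thesis by (simp only: zero_le)
    next
      case True
      define d where "d = norm (x - z)"
      have d: "0 < d" "d < 1" using True by (auto simp: d_def dist_norm)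
      \<comment> \<open>The dyadic shell containing \<^term>\<open>z\<close>.\<close>
      define k where "k = (LEAST k. (1/2) ^ Suc k \<le> d)"
      obtain n where "(1/2 :: real) ^ n < d" using real_arch_pow_inv[OF d(1), of "1/2"] by auto
      then have "(1/2 :: real) ^ Suc n \<le> d"
        using zero_le_power[of "1/2 :: real" n] unfolding power_Suc by linarith
      then have k: "(1/2) ^ Suc k \<le> d"
        unfolding k_def by (rule LeastI)
      have k': "d < (1/2) ^ k"
      proof (cases k)
        case (Suc j)
        then have "\<not> (1/2) ^ Suc j \<le> d"
          using not_less_Least[of j "\<lambda>k. (1/2) ^ Suc k \<le> d"] unfolding k_def by linarith
        then show ?thesis using Suc by simp
      qed (use d in simp)
      have "1 / d \<le> 2 ^ Suc k"
        using k d by (simp add: field_simps)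
      then have "ennreal (1 / d) * indicator (ball x 1) z \<le> ?g k z"
        using True k' by (auto simp: d_def dist_norm ennreal_leI)
      also have "\<dots> \<le> (\<Sum>k. ?g k z)"
      proof -
        have "(\<Sum>k\<in>{k}. ?g k z) \<le> (\<Sum>k. ?g k z)" by (rule sum_le_suminf) auto
        moreover have "(\<Sum>k\<in>{k}. ?g k z) = ?g k z"
          by (subst sum.insert) (simp_all only: finite.emptyI sum.empty add_0_right empty_iff not_False_eq_True)
        ultimately show ?thesis by (simp only:)
      qed
      finally show ?thesis by (simp add: d_def)
    qed
  qed
  also have "\<dots> = (\<Sum>k. \<integral>\<^sup>+z. ?g k z \<partial>lborel)"
    by (rule nn_integral_suminf)
      (intro borel_measurable_times_ennreal borel_measurable_indicator, auto)
  also have "\<dots> = (\<Sum>k. ennreal (2 * c * (1/2) ^ k))"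
  proof (rule arg_cong[of _ _ suminf], rule ext)
    fix k
    have "emeasure lborel (ball x ((1/2) ^ k)) = ennreal (measure lborel (ball x ((1/2) ^ k)))"
      by (rule emeasure_eq_ennreal_measure)
        (rule less_imp_neq[OF emeasure_lborel_ball_finite[unfolded infinity_ennreal_def]])
    also have "\<dots> = ennreal (((1/2) ^ k)\<^sup>2 * c)"
      by (subst content_ball_conv_unit_ball) (auto simp: c_def)
    finally have "(\<integral>\<^sup>+z. ?g k z \<partial>lborel) = ennreal (2 ^ Suc k) * ennreal (((1/2) ^ k)\<^sup>2 * c)"
      by (simp add: nn_integral_cmult_indicator)
    also have "\<dots> = ennreal (2 ^ Suc k * (((1/2) ^ k)\<^sup>2 * c))"
      by (rule ennreal_mult[symmetric]) (use c in auto)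
    also have "(2::real) ^ Suc k * (((1/2) ^ k)\<^sup>2 * c) = 2 * c * (1/2) ^ k"
      by (simp add: power_one_over power2_eq_square field_simps)
    finally show "(\<integral>\<^sup>+z. ?g k z \<partial>lborel) = ennreal (2 * c * (1/2) ^ k)" .
  qed
  also have "\<dots> = ennreal (\<Sum>k. 2 * c * (1/2) ^ k)"
    by (rule suminf_ennreal2) (use c in \<open>auto intro!: summable_mult\<close>)
  also have "(\<Sum>k. 2 * c * (1/2 :: real) ^ k) = 4 * c"
    by (subst suminf_mult) (auto simp: suminf_geometric)
  finally show ?thesis by (simp add: c_def)
qed

definition log_kernel :: "real^2 \<Rightarrow> real^2 \<Rightarrow> real" where
  "log_kernel x y = 1 / (2 * pi) * ln (1 / norm (x - y))"

lemma log_kernel_commute: "log_kernel x y = log_kernel y x"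
  by (simp add: log_kernel_def norm_minus_commute)

lemma log_kernel_measurable:
  fixes f g :: "'a \<Rightarrow> real^2"
  assumes [measurable]: "f \<in> borel_measurable M" "g \<in> borel_measurable M"
  shows "(\<lambda>p. log_kernel (f p) (g p)) \<in> borel_measurable M"
  unfolding log_kernel_def by measurable

definition log_energy :: "(real^2) set \<Rightarrow> (real^2 \<Rightarrow> real) \<Rightarrow> real" where
  "log_energy \<Omega> u = (LINT x|lebesgue_on \<Omega>. u x * log_potential \<Omega> u x)"

lemma log_potential_eq_integral_log_kernel:
  "log_potential \<Omega> u x = (LINT y|lebesgue_on \<Omega>. log_kernel x y * u y)"
  by (simp add: log_potential_def log_kernel_def mult.assoc)

text \<open>Any two points of the ball of radius $1/2$ are at distance less than $1$, so the kernel is positive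
off the diagonal. The estimates hold for points \<^term>\<open>x\<close> of the closed ball of radius $1/2$, not
only of \<^term>\<open>\<Omega>\<close>: Arzela--Ascoli needs a compact set on which the potentials are defined.\<close>

locale small_domain =
  fixes \<Omega> :: "(real^2) set"
  assumes sets_Omega: "\<Omega> \<in> sets lebesgue"
    and Omega_subset: "\<Omega> \<subseteq> ball 0 (1/2)"
begin

abbreviation M where "M \<equiv> lebesgue_on \<Omega>"

definition row_bound where "row_bound = 4 * measure lborel (ball (0 :: real^2) 1)"

lemma row_bound_nonneg: "0 \<le> row_bound"
  by (simp add: row_bound_def)

lemma space_M: "space M = \<Omega>" by simp

lemma finite_measure_M: "finite_measure M"
proof (rule finite_measure_lebesgue_on)
  show "\<Omega> \<in> lmeasurable"
    by (rule bounded_set_imp_lmeasurable[OF _ sets_Omega])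
      (rule bounded_subset[OF bounded_ball Omega_subset])
qed

lemma measurable_M_borel: "f \<in> borel_measurable borel \<Longrightarrow> f \<in> borel_measurable M"
  by (intro measurable_restrict_space1 measurable_completion) simp

lemma AE_M_neq: "AE y in M. y \<noteq> x"
proof -
  have "AE y in lebesgue. y \<noteq> x"
    using AE_not_in[of "{x}" lebesgue] by (simp add: negligible_iff_null_sets[symmetric])
  then have "AE y in lebesgue. y \<in> \<Omega> \<longrightarrow> y \<noteq> x" by (rule AE_mp) simp
  then show ?thesis using sets_Omega by (simp add: AE_restrict_space_iff)
qed

lemma norm_diff_less_1:
  assumes "x \<in> cball 0 (1/2)" "z \<in> \<Omega>" shows "norm (x - z) < 1"
proof -
  have "norm z < 1/2" using Omega_subset assms(2) by auto
  then show ?thesis using assms(1) norm_triangle_ineq4[of x z] by simp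
qed

lemma inverse_distance:
  assumes x: "x \<in> cball 0 (1/2)"
  shows "integrable M (\<lambda>z. 1 / norm (x - z))" "(\<integral>z. 1 / norm (x - z) \<partial>M) \<le> row_bound"
proof -
  have meas: "(\<lambda>z. 1 / norm (x - z)) \<in> borel_measurable M"
    by (rule measurable_M_borel) measurable
  have "(\<integral>\<^sup>+z. ennreal (1 / norm (x - z)) \<partial>M) =
      (\<integral>\<^sup>+z. ennreal (1 / norm (x - z)) * indicator \<Omega> z \<partial>lebesgue)"
    by (rule nn_integral_restrict_space) (simp add: sets_Omega)
  also have "\<dots> \<le> (\<integral>\<^sup>+z. ennreal (1 / norm (x - z)) * indicator (ball x 1) z \<partial>lebesgue)"
    by (rule nn_integral_mono) (use norm_diff_less_1[OF x] in \<open>auto simp: indicator_def dist_norm\<close>)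
  also have "\<dots> = (\<integral>\<^sup>+z. ennreal (1 / norm (x - z)) * indicator (ball x 1) z \<partial>lborel)"
    by (rule nn_integral_completion) 
  also have "\<dots> \<le> ennreal row_bound"
    unfolding row_bound_def by (rule nn_integral_inverse_distance_le)
  finally have le: "(\<integral>\<^sup>+z. ennreal (1 / norm (x - z)) \<partial>M) \<le> ennreal row_bound" .
  show int: "integrable M (\<lambda>z. 1 / norm (x - z))"
    by (rule integrableI_nonneg[OF meas]) (use le in \<open>auto simp: le_less_trans ennreal_less_top\<close>)
  show "(\<integral>z. 1 / norm (x - z) \<partial>M) \<le> row_bound"
    by (subst integral_eq_nn_integral) (use meas le row_bound_nonneg in \<open>auto simp: enn2real_leI\<close>)
qed

lemma log_kernel_row:
  assumes x: "x \<in> cball 0 (1/2)"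
  shows "log_kernel x \<in> square_integrable M" "(\<integral>y. (log_kernel x y)\<^sup>2 \<partial>M) \<le> row_bound"
proof -
  have meas: "log_kernel x \<in> borel_measurable M"
    by (rule measurable_M_borel) (rule log_kernel_measurable, auto)
  have le: "(log_kernel x y)\<^sup>2 \<le> 1 / norm (x - y)" if y: "y \<in> \<Omega>" for y
  proof (cases "x = y")
    case False
    have "1 \<le> pi\<^sup>2" by (rule one_le_power) (use pi_gt3 in simp)
    have "(log_kernel x y)\<^sup>2 = (1 / (2 * pi))\<^sup>2 * (ln (norm (x - y)))\<^sup>2"
      using False by (simp add: log_kernel_def power_mult_distrib power_divide ln_div)
    also have "\<dots> \<le> (1 / (2 * pi))\<^sup>2 * (4 / norm (x - y))"
      by (intro mult_left_mono ln_square_le) (use False norm_diff_less_1[OF x y] in auto)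
    also have "\<dots> = (1 / pi\<^sup>2) * (1 / norm (x - y))" by (simp add: power2_eq_square)
    also have "\<dots> \<le> 1 * (1 / norm (x - y))"
      by (rule mult_right_mono) (use \<open>1 \<le> pi\<^sup>2\<close> in auto)
    finally show ?thesis by simp
  qed (simp add: log_kernel_def)
  have int: "integrable M (\<lambda>y. (log_kernel x y)\<^sup>2)"
    by (rule Bochner_Integration.integrable_bound[OF inverse_distance(1)[OF x]])
      (use meas le in \<open>auto intro!: AE_I2\<close>)
  then show "log_kernel x \<in> square_integrable M" using meas by (simp add: square_integrable_def)
  have "(\<integral>y. (log_kernel x y)\<^sup>2 \<partial>M) \<le> (\<integral>y. 1 / norm (x - y) \<partial>M)"
    by (rule integral_mono[OF int inverse_distance(1)[OF x]]) (simp add: le)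
  with inverse_distance(2)[OF x] show "(\<integral>y. (log_kernel x y)\<^sup>2 \<partial>M) \<le> row_bound" by linarith
qed

lemma Omega_cball: "x \<in> \<Omega> \<Longrightarrow> x \<in> cball 0 (1/2)"
  using Omega_subset by auto

sublocale symmetric_kernel M log_kernel row_bound
proof (intro symmetric_kernel.intro symmetric_kernel_axioms.intro finite_measure_M row_bound_nonneg)
  have "(\<lambda>x. x) \<in> measurable M borel" by (rule measurable_M_borel) simp
  then show "(\<lambda>p. log_kernel (fst p) (snd p)) \<in> borel_measurable (M \<Otimes>\<^sub>M M)"
    by (intro log_kernel_measurable)
      (use measurable_compose[OF measurable_fst] measurable_compose[OF measurable_snd] in blast)+
qed (auto simp: log_kernel_commute intro!: log_kernel_row Omega_cball)

lemma T_eq: "T = log_potential \<Omega>"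
  by (intro ext) (simp add: T_def log_potential_eq_integral_log_kernel)

lemma E_eq: "E = log_energy \<Omega>"
  by (intro ext) (simp add: E_def T_eq log_energy_def)

lemma L2_eq: "L2 = L2_on \<Omega>"
  by (simp add: square_integrable_def L2_on_def)

text \<open>Logarithmic potentials of bounded $L^2$ norm are uniformly Hoelder continuous with exponent $1/2$,
because $z \mapsto k(x,z) - k(y,z)$ has squared $L^2$ norm of order $|x - y|$.\<close>

lemma log_potential_Hoelder:
  assumes u: "u \<in> L2" and x: "x \<in> cball 0 (1/2)" and y: "y \<in> cball 0 (1/2)"
  shows "(log_potential \<Omega> u x - log_potential \<Omega> u y)\<^sup>2 \<le> 8 * row_bound * norm (x - y) * norm2 u"
proof -
  define d where "d z = 1 * log_kernel x z + (-1) * log_kernel y z" for z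
  have d: "d \<in> L2" unfolding d_def
    by (rule square_integrable_lincomb(1)[OF log_kernel_row(1)[OF x] log_kernel_row(1)[OF y]])
  have "log_potential \<Omega> u x - log_potential \<Omega> u y = (\<integral>z. d z * u z \<partial>M)"
    unfolding log_potential_eq_integral_log_kernel d_def
    using square_integrable_mult[OF log_kernel_row(1)[OF x] u]
      square_integrable_mult[OF log_kernel_row(1)[OF y] u]
    by (simp add: left_diff_distrib)
  then have "(log_potential \<Omega> u x - log_potential \<Omega> u y)\<^sup>2 \<le> (\<integral>z. (d z)\<^sup>2 \<partial>M) * norm2 u"
    using integral_Cauchy_Schwarz[OF d u] by (simp add: norm2_def)
  also have "\<dots> \<le> (8 * row_bound * norm (x - y)) * norm2 u"
  proof (rule mult_right_mono[OF _ norm2_nonneg])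
    have "(\<integral>z. (d z)\<^sup>2 \<partial>M) \<le>
        (\<integral>z. 4 * norm (x - y) * (1 / norm (x - z)) + 4 * norm (x - y) * (1 / norm (y - z)) \<partial>M)"
    proof (rule integral_mono_AE[OF square_integrable_power2[OF d]])
      show "integrable M (\<lambda>z. 4 * norm (x - y) * (1 / norm (x - z)) + 4 * norm (x - y) * (1 / norm (y - z)))"
        by (intro Bochner_Integration.integrable_add integrable_mult_right inverse_distance x y)
      \<comment> \<open>At these two points the kernel has its default value $0$ and the pointwise bound can fail.\<close>
      have "AE z in M. z \<noteq> x \<and> z \<noteq> y"
        by (intro AE_conjI AE_M_neq)
      then show "AE z in M. (d z)\<^sup>2 \<le>
          4 * norm (x - y) * (1 / norm (x - z)) + 4 * norm (x - y) * (1 / norm (y - z))"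
      proof (rule AE_mp, intro AE_I2 impI)
        fix z assume z: "z \<in> space M" "z \<noteq> x \<and> z \<noteq> y"
        have pi: "1 \<le> (2 * pi)\<^sup>2" by (rule one_le_power) (use pi_gt3 in simp)
        have "(d z)\<^sup>2 = (1 / (2 * pi))\<^sup>2 * (ln (norm (x - z)) - ln (norm (y - z)))\<^sup>2"
          using z by (simp add: d_def log_kernel_def ln_div power2_commute
              flip: power_mult_distrib right_diff_distrib) (simp add: field_simps power2_eq_square)
        also have "\<dots> \<le> 1 * (ln (norm (x - z)) - ln (norm (y - z)))\<^sup>2"
          by (rule mult_right_mono) (use pi in \<open>auto simp: power_divide\<close>)
        also have "\<dots> \<le> 4 * \<bar>norm (x - z) - norm (y - z)\<bar> * (1 / norm (x - z) + 1 / norm (y - z))"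
          using ln_diff_square_le[of "norm (x - z)" "norm (y - z)"] z by auto
        also have "\<dots> \<le> 4 * norm (x - y) * (1 / norm (x - z) + 1 / norm (y - z))"
          using norm_triangle_ineq3[of "x - z" "y - z"] by (intro mult_right_mono) auto
        finally show "(d z)\<^sup>2 \<le>
            4 * norm (x - y) * (1 / norm (x - z)) + 4 * norm (x - y) * (1 / norm (y - z))"
          by (simp add: distrib_left)
      qed
    qed
    also have "\<dots> = 4 * norm (x - y) * (\<integral>z. 1 / norm (x - z) \<partial>M) + 4 * norm (x - y) * (\<integral>z. 1 / norm (y - z) \<partial>M)"
      by (simp only: Bochner_Integration.integral_add[OF integrable_mult_right integrable_mult_right]
          inverse_distance(1)[OF x] inverse_distance(1)[OF y] integral_mult_right_zero)
    also have "\<dots> \<le> 4 * norm (x - y) * row_bound + 4 * norm (x - y) * row_bound"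
      by (intro add_mono mult_left_mono inverse_distance x y) auto
    finally show "(\<integral>z. (d z)\<^sup>2 \<partial>M) \<le> 8 * row_bound * norm (x - y)" by (simp add: algebra_simps)
  qed
  finally show ?thesis .
qed

lemma T_compact:
  fixes u :: "nat \<Rightarrow> real^2 \<Rightarrow> real"
  assumes u: "\<And>n. u n \<in> L2 \<and> norm2 (u n) \<le> 1"
  shows "\<exists>g r. strict_mono (r :: nat \<Rightarrow> nat) \<and>
    (\<forall>e>0. \<exists>N. \<forall>n\<ge>N. \<forall>x \<in> space M. \<bar>T (u (r n)) x - g x\<bar> \<le> e)"
proof -
  have bound: "norm (T (u n) x) \<le> sqrt row_bound" if x: "x \<in> cball 0 (1/2)" for n x
  proof -
    have "(T (u n) x)\<^sup>2 \<le> (\<integral>y. (log_kernel x y)\<^sup>2 \<partial>M) * norm2 (u n)"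
      unfolding T_def norm2_def
      by (rule integral_Cauchy_Schwarz[OF log_kernel_row(1)[OF x]]) (use u in blast)
    also have "\<dots> \<le> row_bound * 1"
      by (rule mult_mono[OF log_kernel_row(2)[OF x]]) (use u norm2_nonneg row_bound_nonneg in auto)
    finally show ?thesis using real_sqrt_le_mono by fastforce
  qed
  have equi: "\<exists>d>0. \<forall>n y. y \<in> cball 0 (1/2) \<and> norm (x - y) < d \<longrightarrow> norm (T (u n) x - T (u n) y) < e"
    if x: "x \<in> cball 0 (1/2)" and e: "0 < e" for x e
  proof (intro exI[of _ "e\<^sup>2 / (8 * row_bound + 1)"] conjI allI impI)
    show "0 < e\<^sup>2 / (8 * row_bound + 1)" using e row_bound_nonneg by (simp add: add_nonneg_pos)
    fix n y assume y: "y \<in> cball 0 (1/2) \<and> norm (x - y) < e\<^sup>2 / (8 * row_bound + 1)"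
    have "(T (u n) x - T (u n) y)\<^sup>2 \<le> 8 * row_bound * norm (x - y) * norm2 (u n)"
      unfolding T_eq by (rule log_potential_Hoelder) (use u x y in auto)
    also have "\<dots> \<le> 8 * row_bound * norm (x - y) * 1"
      by (rule mult_left_mono) (use u row_bound_nonneg in auto)
    also have "\<dots> \<le> (8 * row_bound + 1) * norm (x - y)" by (simp add: distrib_right)
    also have "\<dots> < e\<^sup>2" using y row_bound_nonneg by (simp add: field_simps add_nonneg_pos)
    finally show "norm (T (u n) x - T (u n) y) < e"
      using e by (metis abs_le_square_iff abs_of_pos not_less real_norm_def)
  qed
  obtain g r where "strict_mono (r :: nat \<Rightarrow> nat)"
    and g: "\<And>e. 0 < e \<Longrightarrow> \<exists>N. \<forall>n x. n \<ge> N \<and> x \<in> cball 0 (1/2) \<longrightarrow> norm (T (u (r n)) x - g x) < e"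
    by (rule Arzela_Ascoli[of "cball (0::real^2) (1/2)" "\<lambda>n. T (u n)" "sqrt row_bound"])
      (use bound equi compact_cball in blast)+
  moreover have "\<exists>N. \<forall>n\<ge>N. \<forall>x \<in> space M. \<bar>T (u (r n)) x - g x\<bar> \<le> e" if "0 < e" for e
    using g[OF that] Omega_cball by (simp add: less_imp_le) (meson less_imp_le)
  ultimately show ?thesis by blast
qed

lemma log_kernel_pos:
  assumes "x \<in> \<Omega>" "y \<in> \<Omega>" "x \<noteq> y" shows "0 < log_kernel x y"
proof -
  have "norm (x - y) < 1" by (rule norm_diff_less_1[OF Omega_cball[OF assms(1)] assms(2)])
  then show ?thesis using assms(3) by (simp add: log_kernel_def)
qed

lemma log_kernel_nonneg: "\<lbrakk>x \<in> \<Omega>; y \<in> \<Omega>\<rbrakk> \<Longrightarrow> 0 \<le> log_kernel x y"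
  using log_kernel_pos[of x y] by (cases "x = y") (auto simp: log_kernel_def)

text \<open>Positivity improvement: the kernel is positive off the diagonal, which for fixed \<^term>\<open>x\<close>
is a single point.\<close>

lemma T_pos:
  assumes u: "u \<in> L2" "0 < norm2 u" "\<And>y. y \<in> \<Omega> \<Longrightarrow> 0 \<le> u y" and x: "x \<in> \<Omega>"
  shows "0 < T u x"
proof -
  have int: "integrable M (\<lambda>y. log_kernel x y * u y)"
    by (rule square_integrable_mult[OF log_kernel_row(1)[OF Omega_cball[OF x]] u(1)])
  have nonneg: "AE y in M. 0 \<le> log_kernel x y * u y"
    by (rule AE_I2) (use log_kernel_nonneg[OF x] u(3) in auto)
  have "T u x \<noteq> 0"
  proof
    assume "T u x = 0"
    then have "AE y in M. log_kernel x y * u y = 0"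
      using integral_nonneg_eq_0_iff_AE[OF int nonneg] by (simp add: T_def)
    moreover have "AE y in M. y \<noteq> x" by (rule AE_M_neq)
    ultimately have "AE y in M. (u y)\<^sup>2 = 0"
    proof (rule AE_mp[OF AE_conjI], intro AE_I2 impI)
      fix y assume "y \<in> space M" "log_kernel x y * u y = 0 \<and> y \<noteq> x"
      then show "(u y)\<^sup>2 = 0" using log_kernel_pos[OF x, of y] by auto
    qed
    then have "norm2 u = 0"
      unfolding norm2_def by (rule integral_eq_zero_AE)
    with u(2) show False by simp
  qed
  moreover have "0 \<le> T u x"
    unfolding T_def by (rule integral_nonneg_AE[OF nonneg])
  ultimately show ?thesis by simp
qed

text \<open>The maximum of the energy on the unit sphere is an eigenvalue. No eigenvalue exceeds it, since the
energy of an eigenfunction is its eigenvalue times its squared norm. So the greatest eigenvalue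
exists and is this maximum. The nonnegative maximiser is a positive multiple of its own image, hence
strictly positive.\<close>

theorem tau1_variational:
  assumes "0 < measure lebesgue \<Omega>"
  shows "\<And>w. w \<in> L2_on \<Omega> \<Longrightarrow> log_energy \<Omega> w \<le> tau1 \<Omega> * (LINT x|lebesgue_on \<Omega>. (w x)\<^sup>2)"
    and "\<exists>u \<in> L2_on \<Omega>. (\<forall>x\<in>\<Omega>. 0 < u x) \<and> 0 < (LINT x|lebesgue_on \<Omega>. (u x)\<^sup>2) \<and>
      log_energy \<Omega> u = tau1 \<Omega> * (LINT x|lebesgue_on \<Omega>. (u x)\<^sup>2)"
proof -
  have m: "0 < measure M (space M)"
    using assms sets_Omega by (simp add: measure_restrict_space)
  have E_somewhere_pos: "\<exists>u \<in> L2. 0 < E u"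
  proof
    define w :: "real^2 \<Rightarrow> real" where "w = (\<lambda>_. 1)"
    show w: "w \<in> L2" by (simp add: w_def square_integrable_def)
    have Tw: "0 < T w x" if "x \<in> \<Omega>" for x
      by (rule T_pos[OF w]) (use m that in \<open>auto simp: w_def norm2_def\<close>)
    have int: "integrable M (\<lambda>x. w x * T w x)" by (rule square_integrable_mult[OF w T_L2[OF w]])
    have nn: "AE x in M. 0 \<le> w x * T w x"
      by (rule AE_I2) (use Tw in \<open>auto simp: w_def less_imp_le\<close>)
    have "E w \<noteq> 0"
    proof
      assume "E w = 0"
      then have "AE x in M. w x * T w x = 0"
        using integral_nonneg_eq_0_iff_AE[OF int nn] by (simp add: E_def)
      then have "AE x in M. False"
      proof (rule AE_mp, intro AE_I2 impI)
        fix x assume "x \<in> space M" "w x * T w x = 0"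
        then show False using Tw[of x] by (simp add: w_def)
      qed
      then have "emeasure M (space M) = 0"
        using ae_filter_eq_bot_iff eventually_False by metis
      then show False using m by (simp add: measure_def)
    qed
    moreover have "0 \<le> E w" unfolding E_def by (rule integral_nonneg_AE[OF nn])
    ultimately show "0 < E w" by simp
  qed
  have K_nonneg: "0 \<le> log_kernel x y" if "x \<in> space M" "y \<in> space M" for x y
    using that log_kernel_nonneg by simp
  obtain S u where S: "0 < S" and u: "u \<in> L2" "0 < norm2 u" "\<And>x. x \<in> \<Omega> \<Longrightarrow> 0 \<le> u x"
    and Tu: "\<And>x. x \<in> \<Omega> \<Longrightarrow> T u x = S * u x"
    and max: "\<And>w. w \<in> L2 \<Longrightarrow> E w \<le> S * norm2 w"
    by (rule top_eigenfunction_exists[OF K_nonneg E_somewhere_pos T_compact, unfolded space_M]) blast+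
  have eq: "E w = \<mu> * norm2 w" if "AE x in M. T w x = \<mu> * w x" "w \<in> L2" for w \<mu>
  proof -
    have [measurable]: "w \<in> borel_measurable M" "T w \<in> borel_measurable M"
      using that(2) T_L2[OF that(2)] by (auto intro: square_integrable_measurable)
    have "E w = (\<integral>x. \<mu> * (w x)\<^sup>2 \<partial>M)"
      unfolding E_def
      by (rule integral_cong_AE) (use that(1) in \<open>auto simp: power2_eq_square\<close>)
    then show ?thesis by (simp add: norm2_def)
  qed
  have pos: "0 < norm2 w" if "w \<in> L2" "\<not> (AE x in M. w x = 0)" for w
  proof -
    have "norm2 w \<noteq> 0"
      using integral_nonneg_eq_0_iff_AE[OF square_integrable_power2[OF that(1)]] that(2)
      by (simp add: norm2_def)
    then show ?thesis using norm2_nonneg[of w] by simp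
  qed
  have tau: "tau1 \<Omega> = S"
    unfolding tau1_def
  proof (rule Greatest_equality)
    have "\<not> (AE x in M. u x = 0)"
    proof
      assume "AE x in M. u x = 0"
      then have "AE x in M. (u x)\<^sup>2 = 0" by simp
      then have "norm2 u = 0" unfolding norm2_def by (rule integral_eq_zero_AE)
      with u(2) show False by simp
    qed
    moreover have "AE x in M. log_potential \<Omega> u x = S * u x"
      by (rule AE_I2) (use Tu in \<open>simp add: T_eq\<close>)
    ultimately show "log_potential_eigenvalue \<Omega> S"
      unfolding log_potential_eigenvalue_def using u(1) L2_eq by blast
    fix \<mu> assume "log_potential_eigenvalue \<Omega> \<mu>"
    then obtain w where w: "w \<in> L2" "\<not> (AE x in M. w x = 0)" "AE x in M. T w x = \<mu> * w x"
      unfolding log_potential_eigenvalue_def L2_eq T_eq by blast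
    have "\<mu> * norm2 w \<le> S * norm2 w" using max[OF w(1)] eq[OF w(3,1)] by simp
    then show "\<mu> \<le> S" using pos[OF w(1,2)] by simp
  qed
  show "log_energy \<Omega> w \<le> tau1 \<Omega> * (LINT x|M. (w x)\<^sup>2)" if "w \<in> L2_on \<Omega>" for w
    using max[of w] that unfolding tau L2_eq E_eq norm2_def .
  have "0 < u x" if "x \<in> \<Omega>" for x
    using T_pos[OF u that] Tu[OF that] S by (simp add: zero_less_mult_iff)
  moreover have "E u = S * norm2 u"
    by (rule eq[OF AE_I2 u(1)]) (use Tu in simp)
  ultimately show "\<exists>u \<in> L2_on \<Omega>. (\<forall>x\<in>\<Omega>. 0 < u x) \<and> 0 < (LINT x|M. (u x)\<^sup>2) \<and>
      log_energy \<Omega> u = tau1 \<Omega> * (LINT x|M. (u x)\<^sup>2)"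
    using u(1,2) unfolding tau L2_eq E_eq norm2_def by blast
qed

end

section \<open>Polarization\<close>

text \<open>Reflection in the vertical line $x_1 = a$.\<close>

definition reflect :: "real \<Rightarrow> real^2 \<Rightarrow> real^2" where
  "reflect a x = x + (2 * (a - x $ 1)) *\<^sub>R axis 1 1"

lemma reflect_nth: "reflect a x $ 1 = 2 * a - x $ 1" "reflect a x $ 2 = x $ 2"
  by (simp_all add: reflect_def axis_def)

lemma reflect_reflect [simp]: "reflect a (reflect a x) = x"
  by (simp add: vec_eq_iff forall_2 reflect_nth)

lemma norm_square_2:
  fixes x :: "real^2" shows "(norm x)\<^sup>2 = (x $ 1)\<^sup>2 + (x $ 2)\<^sup>2"
  unfolding power2_norm_eq_inner inner_vec_def sum_2 by (simp add: power2_eq_square)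

lemma norm_reflect_diff: "norm (reflect a x - reflect a y) = norm (x - y)"
proof -
  have "(norm (reflect a x - reflect a y))\<^sup>2 = (norm (x - y))\<^sup>2"
    by (simp add: norm_square_2 reflect_nth power2_commute)
  then show ?thesis by simp
qed

text \<open>A point is closer to \<^term>\<open>y\<close> than to its mirror image exactly if it lies on the same side of the
line as \<^term>\<open>y\<close>.\<close>

lemma norm_diff_reflect_square:
  "(norm (x - reflect a y))\<^sup>2 = (norm (x - y))\<^sup>2 + 4 * (a - x $ 1) * (a - y $ 1)"
  unfolding norm_square_2 by (simp add: reflect_nth power2_eq_square algebra_simps)

lemma reflect_fixes_line: "x $ 1 = a \<Longrightarrow> reflect a x = x"
  by (simp add: reflect_def)

lemma reflect_measurable: "reflect a \<in> lebesgue \<rightarrow>\<^sub>M lebesgue"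
  and distr_reflect: "distr lebesgue lebesgue (reflect a) = lebesgue"
proof -
  let ?e = "axis 1 1 :: real^2"
  define c :: "real^2 \<Rightarrow> real" where "c j = (if j = ?e then - 1 else 1)" for j
  have e: "?e \<in> Basis" by simp
  have eq: "reflect a = (\<lambda>x. (2 * a) *\<^sub>R ?e + (\<Sum>j\<in>Basis. (c j * (x \<bullet> j)) *\<^sub>R j))"
  proof (rule ext)
    fix x :: "real^2"
    have "(\<Sum>j\<in>Basis. (c j * (x \<bullet> j)) *\<^sub>R j)
        = (\<Sum>j\<in>Basis. (x \<bullet> j) *\<^sub>R j + (if j = ?e then (- 2 * (x \<bullet> ?e)) *\<^sub>R ?e else 0))"
    proof (rule sum.cong[OF refl])
      fix j :: "real^2"
      show "(c j * (x \<bullet> j)) *\<^sub>R j = (x \<bullet> j) *\<^sub>R j + (if j = ?e then (- 2 * (x \<bullet> ?e)) *\<^sub>R ?e else 0)"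
      proof (cases "j = ?e")
        case True
        have "- 1 * (x \<bullet> ?e) = (x \<bullet> ?e) + (- 2 * (x \<bullet> ?e))" by simp
        then show ?thesis by (simp only: c_def True simp_thms if_True scaleR_left_distrib)
      qed (simp add: c_def)
    qed
    also have "\<dots> = x + (- 2 * (x \<bullet> ?e)) *\<^sub>R ?e"
      using e by (simp add: sum.distrib euclidean_representation)
    finally show "reflect a x = (2 * a) *\<^sub>R ?e + (\<Sum>j\<in>Basis. (c j * (x \<bullet> j)) *\<^sub>R j)"
      by (simp add: reflect_def inner_axis algebra_simps scaleR_left_distrib[symmetric])
  qed
  have c: "\<And>j. j \<in> Basis \<Longrightarrow> c j \<noteq> 0" by (simp add: c_def)
  show "reflect a \<in> lebesgue \<rightarrow>\<^sub>M lebesgue"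
    unfolding eq by (rule lebesgue_affine_measurable[OF c])
  have "(\<Prod>j\<in>Basis. \<bar>c j\<bar>) = 1" by (rule prod.neutral) (simp add: c_def)
  moreover have "lebesgue = density (distr lebesgue lebesgue (reflect a)) (\<lambda>_. \<Prod>j\<in>Basis. \<bar>c j\<bar>)"
    unfolding eq by (rule lebesgue_affine_euclidean[OF c])
  ultimately show "distr lebesgue lebesgue (reflect a) = lebesgue"
    by (simp add: density_1)
qed

lemma integral_reflect:
  fixes f :: "real^2 \<Rightarrow> real"
  assumes "integrable lebesgue f"
  shows "integrable lebesgue (\<lambda>x. f (reflect a x))"
    and "(\<integral>x. f (reflect a x) \<partial>lebesgue) = (\<integral>x. f x \<partial>lebesgue)"
proof -
  have f: "f \<in> borel_measurable lebesgue" using assms by simp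
  show "integrable lebesgue (\<lambda>x. f (reflect a x))"
    using assms integrable_distr_eq[OF reflect_measurable f] by (simp add: distr_reflect)
  show "(\<integral>x. f (reflect a x) \<partial>lebesgue) = (\<integral>x. f x \<partial>lebesgue)"
    using integral_distr[OF reflect_measurable f] by (simp add: distr_reflect)
qed

text \<open>Two-point rearrangement: on each pair of mirror points the larger value is moved to the left
half-plane. On the line itself both branches agree, so the choice made there is immaterial.\<close>

definition polarize :: "real \<Rightarrow> (real^2 \<Rightarrow> real) \<Rightarrow> real^2 \<Rightarrow> real" where
  "polarize a u x =
    (if x $ 1 \<le> a then max (u x) (u (reflect a x)) else min (u x) (u (reflect a x)))"

lemma polarize_left:
  assumes "x $ 1 \<le> a"
  shows "polarize a u x = max (u x) (u (reflect a x))"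
    and "polarize a u (reflect a x) = min (u x) (u (reflect a x))"
  using assms reflect_fixes_line[of x a]
  by (cases "x $ 1 = a"; simp add: polarize_def reflect_nth min.commute)+

lemma polarize_right:
  assumes "a \<le> x $ 1"
  shows "polarize a u x = min (u x) (u (reflect a x))"
    and "polarize a u (reflect a x) = max (u x) (u (reflect a x))"
  using polarize_left[of "reflect a x" a u] assms by (simp_all add: reflect_nth max.commute min.commute)

text \<open>The values on each mirror pair are only permuted, and the reflection preserves Lebesgue measure.\<close>

lemma polarize_square_integrable:
  assumes u: "u \<in> square_integrable lebesgue"
  shows "polarize a u \<in> square_integrable lebesgue"
    and "(\<integral>x. (polarize a u x)\<^sup>2 \<partial>lebesgue) = (\<integral>x. (u x)\<^sup>2 \<partial>lebesgue)"
proof -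
  have um: "u \<in> borel_measurable lebesgue" and ui: "integrable lebesgue (\<lambda>x. (u x)\<^sup>2)"
    using u by (auto simp: square_integrable_def)
  note ui' = integral_reflect[OF ui, of a]
  have sum: "(polarize a u x)\<^sup>2 + (polarize a u (reflect a x))\<^sup>2 = (u x)\<^sup>2 + (u (reflect a x))\<^sup>2" for x
    by (cases "x $ 1 \<le> a") (simp_all add: polarize_left polarize_right max_def min_def)
  have ur: "(\<lambda>x. u (reflect a x)) \<in> borel_measurable lebesgue"
    by (rule measurable_compose[OF reflect_measurable um])
  have "(\<lambda>x::real^2. x $ 1) \<in> borel_measurable lebesgue"
    by (intro measurable_completion) simp
  then have "{x::real^2. x $ 1 \<le> a} \<in> sets lebesgue"
    using borel_measurable_iff_le[of "\<lambda>x::real^2. x $ 1" lebesgue] by simp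
  then have pm: "polarize a u \<in> borel_measurable lebesgue"
    unfolding polarize_def
    by (intro measurable_If borel_measurable_max borel_measurable_min um ur) simp
  have pi: "integrable lebesgue (\<lambda>x. (polarize a u x)\<^sup>2)"
  proof (rule Bochner_Integration.integrable_bound)
    show "integrable lebesgue (\<lambda>x. (u x)\<^sup>2 + (u (reflect a x))\<^sup>2)" using ui ui' by simp
    have "(polarize a u x)\<^sup>2 \<le> (u x)\<^sup>2 + (u (reflect a x))\<^sup>2" for x
      using sum[of x] zero_le_power2[of "polarize a u (reflect a x)"] by linarith
    then show "AE x in lebesgue. norm ((polarize a u x)\<^sup>2) \<le> norm ((u x)\<^sup>2 + (u (reflect a x))\<^sup>2)"
      by simp
  qed (use pm in simp)
  then show "polarize a u \<in> square_integrable lebesgue" using pm by (simp add: square_integrable_def)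
  have "2 * (\<integral>x. (polarize a u x)\<^sup>2 \<partial>lebesgue)
      = (\<integral>x. (polarize a u x)\<^sup>2 + (polarize a u (reflect a x))\<^sup>2 \<partial>lebesgue)"
    using pi integral_reflect[OF pi, of a] by simp
  also have "\<dots> = 2 * (\<integral>x. (u x)\<^sup>2 \<partial>lebesgue)"
    unfolding sum using ui ui' by simp
  finally show "(\<integral>x. (polarize a u x)\<^sup>2 \<partial>lebesgue) = (\<integral>x. (u x)\<^sup>2 \<partial>lebesgue)" by simp
qed

text \<open>In both cases the difference is $0$ or $\pm|p - p'||q - q'|$.\<close>

lemma rearrangement_pair:
  fixes p p' q q' :: real
  shows "0 \<le> max p p' * max q q' + min p p' * min q q' - (p * q + p' * q')"
    and "max p p' * min q q' + min p p' * max q q' - (p * q + p' * q') \<le> 0"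
  using mult_nonneg_nonneg[of "p' - p" "q' - q"] mult_nonneg_nonneg[of "p - p'" "q' - q"]
    mult_nonneg_nonneg[of "p' - p" "q - q'"] mult_nonneg_nonneg[of "p - p'" "q - q'"]
  by (cases "p \<le> p'"; cases "q \<le> q'"; simp add: max_def min_def algebra_simps)+

text \<open>The change under polarization of the products attached to the two equidistant pairs $(x,y)$ and
$(x',y')$, a prime marking mirror images. The products for $(x,y')$ and $(x',y)$ change by the
negative of this, because the sum of the values over a mirror pair is preserved.\<close>

definition polarization_gain :: "real \<Rightarrow> (real^2 \<Rightarrow> real) \<Rightarrow> real^2 \<Rightarrow> real^2 \<Rightarrow> real" where
  "polarization_gain a u x y =
    polarize a u x * polarize a u y + polarize a u (reflect a x) * polarize a u (reflect a y)
    - (u x * u y + u (reflect a x) * u (reflect a y))"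

lemma polarization_gain_sign:
  shows "0 < (a - x $ 1) * (a - y $ 1) \<Longrightarrow> 0 \<le> polarization_gain a u x y"
    and "(a - x $ 1) * (a - y $ 1) < 0 \<Longrightarrow> polarization_gain a u x y \<le> 0"
proof -
  note pair = rearrangement_pair[of "u x" "u (reflect a x)" "u y" "u (reflect a y)"]
  assume "0 < (a - x $ 1) * (a - y $ 1)"
  then consider "x $ 1 \<le> a" "y $ 1 \<le> a" | "a \<le> x $ 1" "a \<le> y $ 1"
    by (force simp: zero_less_mult_iff)
  then show "0 \<le> polarization_gain a u x y"
  proof cases
    case 1
    show ?thesis unfolding polarization_gain_def polarize_left[OF 1(1)] polarize_left[OF 1(2)]
      by (rule pair(1))
  next
    case 2
    show ?thesis unfolding polarization_gain_def polarize_right[OF 2(1)] polarize_right[OF 2(2)]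
      using pair(1) by linarith
  qed
next
  note pair = rearrangement_pair[of "u x" "u (reflect a x)" "u y" "u (reflect a y)"]
  assume "(a - x $ 1) * (a - y $ 1) < 0"
  then consider "x $ 1 \<le> a" "a \<le> y $ 1" | "a \<le> x $ 1" "y $ 1 \<le> a"
    by (force simp: mult_less_0_iff)
  then show "polarization_gain a u x y \<le> 0"
  proof cases
    case 1
    show ?thesis unfolding polarization_gain_def polarize_left[OF 1(1)] polarize_right[OF 1(2)]
      by (rule pair(2))
  next
    case 2
    show ?thesis unfolding polarization_gain_def polarize_right[OF 2(1)] polarize_left[OF 2(2)]
      using pair(2) by linarith
  qed
qed

text \<open>Unless it vanishes, each factor has the sign of $(a - x_1)(a - y_1)$: the kernel
decreases with the distance, and polarization gathers the large values on one side. The two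
excluded points are those where the kernel has its default value $0$ instead of $\infty$.\<close>

lemma log_kernel_polarization_nonneg:
  assumes "y \<noteq> x" "y \<noteq> reflect a x"
  shows "0 \<le> (log_kernel x y - log_kernel x (reflect a y)) * polarization_gain a u x y"
proof -
  define c where "c = (a - x $ 1) * (a - y $ 1)"
  have n: "0 < norm (x - y)" "0 < norm (x - reflect a y)"
    using assms reflect_reflect[of a y] by auto
  have sq: "(norm (x - reflect a y))\<^sup>2 = (norm (x - y))\<^sup>2 + 4 * c"
    using norm_diff_reflect_square[of x a y] by (simp add: c_def)
  have K: "log_kernel x y - log_kernel x (reflect a y) =
      1 / (2 * pi) * (ln (norm (x - reflect a y)) - ln (norm (x - y)))"
    using n by (simp add: log_kernel_def ln_div right_diff_distrib)
  consider "c = 0" | "0 < c" | "c < 0" by linarith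
  then show ?thesis
  proof cases
    case 1
    then have "norm (x - reflect a y) = norm (x - y)" using sq by simp
    then show ?thesis by (simp add: K)
  next
    case 2
    then have "(norm (x - y))\<^sup>2 \<le> (norm (x - reflect a y))\<^sup>2" using sq by linarith
    then have "norm (x - y) \<le> norm (x - reflect a y)" by (rule power2_le_imp_le) simp
    then have "0 \<le> log_kernel x y - log_kernel x (reflect a y)"
      using n unfolding K by (intro mult_nonneg_nonneg) auto
    moreover have "0 \<le> polarization_gain a u x y"
      using 2 by (simp add: polarization_gain_sign(1) c_def)
    ultimately show ?thesis by simp
  next
    case 3
    then have "(norm (x - reflect a y))\<^sup>2 \<le> (norm (x - y))\<^sup>2" using sq by linarith
    then have "norm (x - reflect a y) \<le> norm (x - y)" by (rule power2_le_imp_le) simp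
    then have "log_kernel x y - log_kernel x (reflect a y) \<le> 0"
      using n unfolding K by (intro mult_nonneg_nonpos) auto
    moreover have "polarization_gain a u x y \<le> 0"
      using 3 by (simp add: polarization_gain_sign(2) c_def)
    ultimately show ?thesis by (rule mult_nonpos_nonpos)
  qed
qed

text \<open>Polarization swaps the values of \<^term>\<open>u\<close> at \<^term>\<open>x\<close> and its mirror image
and keeps those at \<^term>\<open>y\<close> and its mirror image, so the gain is the product of the two value differences.\<close>

lemma log_kernel_polarization_pos:
  assumes "y \<noteq> x" "x $ 1 < a" "y $ 1 < a" "u x < u (reflect a x)" "u (reflect a y) < u y"
  shows "0 < (log_kernel x y - log_kernel x (reflect a y)) * polarization_gain a u x y"
proof (rule mult_pos_pos)
  have "0 < 4 * (a - x $ 1) * (a - y $ 1)" using assms by simp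
  then have "(norm (x - y))\<^sup>2 < (norm (x - reflect a y))\<^sup>2"
    using norm_diff_reflect_square[of x a y] by linarith
  then have "norm (x - y) < norm (x - reflect a y)" by (rule power2_less_imp_less) simp
  moreover from this have "0 < norm (x - y)" "x \<noteq> reflect a y" using assms(1) by auto
  ultimately show "0 < log_kernel x y - log_kernel x (reflect a y)"
    by (simp add: log_kernel_def ln_div divide_strict_right_mono)
  have "polarization_gain a u x y = (u (reflect a x) - u x) * (u y - u (reflect a y))"
    using assms by (simp add: polarization_gain_def polarize_left algebra_simps)
  then show "0 < polarization_gain a u x y" using assms by simp
qed

lemma log_kernel_reflect: "log_kernel (reflect a x) (reflect a y) = log_kernel x y"
  by (simp add: log_kernel_def norm_reflect_diff)

lemma integral_mult_const_middle:
  fixes f g :: "'a \<Rightarrow> real"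
  shows "(\<integral>y. f y * (c * g y) \<partial>M) = c * (\<integral>y. f y * g y \<partial>M)"
proof -
  have "(\<lambda>y. f y * (c * g y)) = (\<lambda>y. c * (f y * g y))" by (simp add: fun_eq_iff mult.left_commute)
  then show ?thesis by (simp only: integral_mult_right_zero)
qed

lemma integral_lebesgue_on_vanishing:
  fixes f :: "real^2 \<Rightarrow> real"
  assumes "\<Omega> \<in> sets lebesgue" "\<And>x. x \<notin> \<Omega> \<Longrightarrow> f x = 0"
  shows "(\<integral>x. f x \<partial>lebesgue_on \<Omega>) = (\<integral>x. f x \<partial>lebesgue)"
    and "integrable (lebesgue_on \<Omega>) f \<longleftrightarrow> integrable lebesgue f"
proof -
  have "(\<lambda>x. indicator \<Omega> x *\<^sub>R f x) = f"
    using assms(2) by (auto simp: indicator_def fun_eq_iff)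
  then show "(\<integral>x. f x \<partial>lebesgue_on \<Omega>) = (\<integral>x. f x \<partial>lebesgue)"
    "integrable (lebesgue_on \<Omega>) f \<longleftrightarrow> integrable lebesgue f"
    using assms(1) by (simp_all add: integral_restrict_space integrable_restrict_space)
qed

lemma log_energy_eq_plane_integral:
  assumes "\<Omega> \<in> sets lebesgue" "\<And>x. x \<notin> \<Omega> \<Longrightarrow> f x = 0"
  shows "log_energy \<Omega> f = (\<integral>x. \<integral>y. log_kernel x y * (f x * f y) \<partial>lebesgue \<partial>lebesgue)"
proof -
  have 1: "(\<integral>y. log_kernel x y * f y \<partial>lebesgue_on \<Omega>) = (\<integral>y. log_kernel x y * f y \<partial>lebesgue)" for x
    by (rule integral_lebesgue_on_vanishing) (simp_all add: assms)
  show ?thesis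
    unfolding log_energy_def log_potential_eq_integral_log_kernel 1 integral_mult_const_middle
    by (rule integral_lebesgue_on_vanishing) (simp_all add: assms)
qed

lemma square_integrable_lebesgue_on:
  assumes "u \<in> square_integrable lebesgue" "\<Omega> \<in> sets lebesgue"
  shows "u \<in> square_integrable (lebesgue_on \<Omega>)"
  using assms integrable_mult_indicator[of \<Omega> lebesgue "\<lambda>x. (u x)\<^sup>2"]
  by (simp add: square_integrable_def integrable_restrict_space measurable_restrict_space1)

lemma plane_energy_integrable:
  assumes u: "u \<in> square_integrable lebesgue" and supp: "\<And>x. x \<notin> ball 0 (1/2) \<Longrightarrow> u x = 0"
  shows "integrable lebesgue (\<lambda>y. log_kernel x y * (u x * u y))"
    and "integrable lebesgue (\<lambda>x. \<integral>y. log_kernel x y * (u x * u y) \<partial>lebesgue)"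
proof -
  interpret B: small_domain "ball 0 (1/2)" by unfold_locales auto
  have uB: "u \<in> B.L2" by (rule square_integrable_lebesgue_on[OF u]) simp
  have row: "integrable lebesgue (\<lambda>y. log_kernel x y * u y)" if "x \<in> ball 0 (1/2)" for x
  proof -
    have "integrable B.M (\<lambda>y. log_kernel x y * u y)"
      by (rule square_integrable_mult[OF _ uB]) (rule B.log_kernel_row(1)[OF B.Omega_cball[OF that]])
    then show ?thesis
      by (subst (asm) integral_lebesgue_on_vanishing(2)) (simp_all add: supp)
  qed
  show "integrable lebesgue (\<lambda>y. log_kernel x y * (u x * u y))" for x
  proof (cases "x \<in> ball 0 (1/2)")
    case True
    show ?thesis using integrable_mult_right[OF row[OF True], of "u x"] by (simp add: mult.left_commute)
  next
    case False
    show ?thesis by (simp only: supp[OF False] mult_zero_left mult_zero_right integrable_zero)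
  qed
  have "u x * B.T u x = (\<integral>y. log_kernel x y * (u x * u y) \<partial>lebesgue)" for x
    unfolding B.T_def integral_mult_const_middle
    by (subst integral_lebesgue_on_vanishing(1)) (simp_all add: supp)
  moreover have "integrable B.M (\<lambda>x. u x * B.T u x)"
    by (rule square_integrable_mult[OF uB B.T_L2[OF uB]])
  then have "integrable lebesgue (\<lambda>x. u x * B.T u x)"
    by (subst (asm) integral_lebesgue_on_vanishing(2)) (simp_all add: supp)
  ultimately show "integrable lebesgue (\<lambda>x. \<integral>y. log_kernel x y * (u x * u y) \<partial>lebesgue)"
    by (simp only:)
qed

text \<open>The integral over the plane does not change when either variable is reflected. Averaging the
energy difference over the four combinations of reflections turns its integrand into the
product of \<^term>\<open>log_kernel x y - log_kernel x (reflect a y)\<close> and the gain,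
which is nonnegative almost everywhere. Were the integral zero, the integrand would vanish for
almost all \<^term>\<open>y\<close> for almost every \<^term>\<open>x\<close>, but it is positive when \<^term>\<open>x\<close> and \<^term>\<open>y\<close> range over
the sets in the last two hypotheses.\<close>

theorem polarization_increases_energy:
  assumes u: "u \<in> square_integrable lebesgue"
    and supp: "\<And>x. x \<notin> ball 0 (1/2) \<Longrightarrow> u x = 0" "\<And>x. x \<notin> ball 0 (1/2) \<Longrightarrow> polarize a u x = 0"
    and A: "\<not> (AE x in lebesgue. \<not> (x $ 1 < a \<and> u x < u (reflect a x)))"
    and B: "\<not> (AE y in lebesgue. \<not> (y $ 1 < a \<and> u (reflect a y) < u y))"
  shows "(\<integral>x. \<integral>y. log_kernel x y * (u x * u y) \<partial>lebesgue \<partial>lebesgue)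
    < (\<integral>x. \<integral>y. log_kernel x y * (polarize a u x * polarize a u y) \<partial>lebesgue \<partial>lebesgue)"
proof -
  define v where "v = polarize a u"
  define G where "G x y = log_kernel x y * (v x * v y) - log_kernel x y * (u x * u y)" for x y
  define I where "I x = (\<integral>y. G x y \<partial>lebesgue)" for x
  define N where "N x y = (log_kernel x y - log_kernel x (reflect a y)) * polarization_gain a u x y" for x y
  have v: "v \<in> square_integrable lebesgue" "\<And>x. x \<notin> ball 0 (1/2) \<Longrightarrow> v x = 0"
    using polarize_square_integrable(1)[OF u] supp(2) by (auto simp: v_def)
  note iu = plane_energy_integrable[OF u supp(1)] and iv = plane_energy_integrable[OF v]
  have G_int: "integrable lebesgue (G x)" for x
    unfolding G_def using iu(1) iv(1) by simp
  have I_eq: "I x = (\<integral>y. log_kernel x y * (v x * v y) \<partial>lebesgue) - (\<integral>y. log_kernel x y * (u x * u y) \<partial>lebesgue)" for x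
    unfolding I_def G_def using iu(1) iv(1) by simp
  have I_int: "integrable lebesgue I"
    unfolding I_eq using iu(2) iv(2) by simp
  note Gr = integral_reflect[OF G_int, of _ a] and Ir = integral_reflect[OF I_int, of a]
  have N_eq: "N x y = (G x y + G x (reflect a y)) + (G (reflect a x) y + G (reflect a x) (reflect a y))" for x y
  proof -
    have pair: "v z + v (reflect a z) = u z + u (reflect a z)" for z
      unfolding v_def by (cases "z $ 1 \<le> a") (simp_all add: polarize_left polarize_right max_def min_def)
    have vx: "v (reflect a x) = u x + u (reflect a x) - v x"
      and vy: "v (reflect a y) = u y + u (reflect a y) - v y"
      using pair[of x] pair[of y] by simp_all
    have K: "log_kernel (reflect a x) y = log_kernel x (reflect a y)"
      using log_kernel_reflect[of a x "reflect a y"] by simp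
    show ?thesis
      unfolding N_def G_def polarization_gain_def v_def[symmetric] log_kernel_reflect K vx vy
      by (simp add: algebra_simps)
  qed
  have N_int: "integrable lebesgue (N x)" for x
    unfolding N_eq using G_int Gr(1) by simp
  have J_eq: "(\<integral>y. N x y \<partial>lebesgue) = 2 * I x + 2 * I (reflect a x)" for x
    unfolding N_eq using G_int Gr by (simp add: I_def)
  have J_int: "integrable lebesgue (\<lambda>x. \<integral>y. N x y \<partial>lebesgue)"
    unfolding J_eq using I_int Ir(1) by simp
  have neq: "AE y in lebesgue. y \<noteq> x" for x :: "real^2"
    using AE_not_in[of "{x}" lebesgue] by (simp add: negligible_iff_null_sets[symmetric])
  have N_nonneg: "AE y in lebesgue. 0 \<le> N x y" for x
    using neq[of x] neq[of "reflect a x"]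
    by eventually_elim (simp add: N_def log_kernel_polarization_nonneg)
  have J_nonneg: "AE x in lebesgue. 0 \<le> (\<integral>y. N x y \<partial>lebesgue)"
    by (intro AE_I2 integral_nonneg_AE N_nonneg)
  have "(\<integral>x. \<integral>y. N x y \<partial>lebesgue \<partial>lebesgue) \<noteq> 0"
  proof
    assume "(\<integral>x. \<integral>y. N x y \<partial>lebesgue \<partial>lebesgue) = 0"
    then have zero: "AE x in lebesgue. (\<integral>y. N x y \<partial>lebesgue) = 0"
      using integral_nonneg_eq_0_iff_AE[OF J_int J_nonneg] by simp
    have "AE x in lebesgue. \<not> (x $ 1 < a \<and> u x < u (reflect a x))"
      using zero
    proof (rule AE_mp, intro AE_I2 impI notI)
      fix x assume x: "(\<integral>y. N x y \<partial>lebesgue) = 0" "x $ 1 < a \<and> u x < u (reflect a x)"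
      then have "AE y in lebesgue. N x y = 0"
        using integral_nonneg_eq_0_iff_AE[OF N_int N_nonneg] by simp
      with neq[of x] have "AE y in lebesgue. \<not> (y $ 1 < a \<and> u (reflect a y) < u y)"
      proof eventually_elim
        case (elim y)
        then show ?case
          using log_kernel_polarization_pos[of y x a u] x(2) by (auto simp: N_def)
      qed
      with B show False ..
    qed
    with A show False ..
  qed
  moreover have "0 \<le> (\<integral>x. \<integral>y. N x y \<partial>lebesgue \<partial>lebesgue)"
    by (rule integral_nonneg_AE[OF J_nonneg])
  moreover have "(\<integral>x. \<integral>y. N x y \<partial>lebesgue \<partial>lebesgue) = 4 * (\<integral>x. I x \<partial>lebesgue)"
    unfolding J_eq using I_int Ir by simp
  ultimately have "0 < (\<integral>x. I x \<partial>lebesgue)" by simp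
  then show ?thesis unfolding I_eq using iu(2) iv(2) by (simp add: v_def)
qed

section \<open>Eccentric annuli\<close>

lemma open_imp_not_AE_avoided:
  fixes U :: "(real^2) set"
  assumes "open U" "p \<in> U" "\<And>x. x \<in> U \<Longrightarrow> P x"
  shows "\<not> (AE x in lebesgue. \<not> P x)"
proof
  assume "AE x in lebesgue. \<not> P x"
  then have "AE x in lebesgue. x \<notin> U" by (rule AE_mp) (use assms(3) in auto)
  moreover have "U \<in> sets lebesgue" using assms(1) by simp
  ultimately have "negligible U"
    by (simp add: negligible_iff_null_sets AE_iff_null_sets)
  then show False using open_not_negligible[OF assms(1)] assms(2) by blast
qed

lemma square_integrable_extend_zero:
  assumes "\<Omega> \<in> sets lebesgue" "u \<in> L2_on \<Omega>"
  shows "(\<lambda>x. if x \<in> \<Omega> then u x else 0) \<in> square_integrable lebesgue"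
proof -
  have "integrable (lebesgue_on \<Omega>) (\<lambda>x. (if x \<in> \<Omega> then u x else 0)\<^sup>2)"
    by (rule Bochner_Integration.integrable_cong[THEN iffD1, of "lebesgue_on \<Omega>" _ "\<lambda>x. (u x)\<^sup>2"])
      (use assms(2) in \<open>auto simp: L2_on_def\<close>)
  then have "integrable lebesgue (\<lambda>x. (if x \<in> \<Omega> then u x else 0)\<^sup>2)"
    by (subst (asm) integral_lebesgue_on_vanishing(2)) (simp_all add: assms)
  moreover have "(\<lambda>x. if x \<in> \<Omega> then u x else 0) \<in> borel_measurable lebesgue"
    using assms by (simp add: borel_measurable_if L2_on_def)
  ultimately show ?thesis by (simp add: square_integrable_def)
qed

abbreviation e1 :: "real^2" where "e1 \<equiv> axis 1 1"

lemma norm_diff_e1_square: "(norm (x - c *\<^sub>R e1))\<^sup>2 = (x $ 1 - c)\<^sup>2 + (x $ 2)\<^sup>2"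
  unfolding norm_square_2 by (simp add: axis_def)

lemma mem_annulus:
  "x \<in> eccentric_annulus R r t \<longleftrightarrow> norm x < R \<and> r < norm (x - t *\<^sub>R e1)"
  by (auto simp: eccentric_annulus_def dist_norm norm_minus_commute)

lemma norm_reflect_diff_e1:
  "norm (reflect ((s + t) / 2) x - t *\<^sub>R e1) = norm (x - s *\<^sub>R e1)"
proof -
  have "(norm (reflect ((s + t) / 2) x - t *\<^sub>R e1))\<^sup>2 = (norm (x - s *\<^sub>R e1))\<^sup>2"
    unfolding norm_diff_e1_square by (simp add: reflect_nth power2_eq_square algebra_simps)
  then show ?thesis by simp
qed

lemma norm_reflect_ge:
  assumes "0 \<le> a" "x $ 1 \<le> a" shows "norm x \<le> norm (reflect a x)"
proof -
  have "0 \<le> 4 * a * (a - x $ 1)" using assms by simp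
  then have "(norm x)\<^sup>2 \<le> (norm (reflect a x))\<^sup>2"
    unfolding norm_square_2 by (simp add: reflect_nth power2_eq_square algebra_simps)
  then show ?thesis by (rule power2_le_imp_le) simp
qed

lemma norm_diff_e1_le:
  assumes "t \<le> s" "x $ 1 \<le> (s + t) / 2"
  shows "norm (x - t *\<^sub>R e1) \<le> norm (x - s *\<^sub>R e1)"
proof -
  have "0 \<le> (s - t) * (s + t - 2 * x $ 1)" using assms by simp
  then have "(norm (x - t *\<^sub>R e1))\<^sup>2 \<le> (norm (x - s *\<^sub>R e1))\<^sup>2"
    unfolding norm_diff_e1_square by (simp add: power2_eq_square algebra_simps)
  then show ?thesis by (rule power2_le_imp_le) simp
qed

text \<open>Reflection in the line midway between the centres $te_1$ and $se_1$ exchanges the holes. Left of that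
line a point outside the disc has its mirror image outside the disc, and a point of the hole around
$se_1$ lies, like its mirror image, in the hole around $te_1$. Right of the line one vanishing value
suffices, as polarization takes the minimum there.\<close>

lemma polarize_vanishes_off_annulus:
  assumes "0 \<le> t" "t \<le> s" "\<And>x. 0 \<le> u x" "\<And>x. x \<notin> eccentric_annulus R r t \<Longrightarrow> u x = 0"
    and x: "x \<notin> eccentric_annulus R r s"
  shows "polarize ((s + t) / 2) u x = 0"
proof (cases "x $ 1 \<le> (s + t) / 2")
  case True
  define y where "y = reflect ((s + t) / 2) x"
  have "norm x \<le> norm y" unfolding y_def by (rule norm_reflect_ge) (use assms True in auto)
  moreover have "norm (y - t *\<^sub>R e1) = norm (x - s *\<^sub>R e1)" unfolding y_def by (rule norm_reflect_diff_e1)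
  moreover have "norm (x - t *\<^sub>R e1) \<le> norm (x - s *\<^sub>R e1)"
    by (rule norm_diff_e1_le[OF assms(2) True])
  ultimately have "x \<notin> eccentric_annulus R r t" "y \<notin> eccentric_annulus R r t"
    using x by (auto simp: mem_annulus)
  then show ?thesis using True assms(4) by (simp add: polarize_def y_def)
next
  case False
  define y where "y = reflect ((s + t) / 2) x"
  have "norm (y - t *\<^sub>R e1) = norm (x - s *\<^sub>R e1)" unfolding y_def by (rule norm_reflect_diff_e1)
  then have "x \<notin> eccentric_annulus R r t \<or> y \<notin> eccentric_annulus R r t"
    using x by (auto simp: mem_annulus)
  then have "u x = 0 \<or> u y = 0" using assms(4) by blast
  then have "min (u x) (u y) = 0" using assms(3)[of x] assms(3)[of y] by (auto simp: min_def)
  then show ?thesis using False by (simp add: polarize_def y_def)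
qed

lemma open_annulus: "open (eccentric_annulus R r t)"
  unfolding eccentric_annulus_def by (intro open_Diff open_ball closed_cball)

lemma annulus_subset: "R < 1/2 \<Longrightarrow> eccentric_annulus R r t \<subseteq> ball 0 (1/2)"
  by (auto simp: eccentric_annulus_def)

lemma norm_scaleR_e1: "norm (c *\<^sub>R e1) = \<bar>c\<bar>" "norm (c *\<^sub>R e1 - d *\<^sub>R e1) = \<bar>c - d\<bar>"
  by (simp_all add: norm_axis_1 flip: scaleR_diff_left)

lemma measure_annulus_pos:
  assumes "0 < r" "r < R" "0 \<le> t"
  shows "0 < measure lebesgue (eccentric_annulus R r t)"
proof -
  define e where "e = (R - r) / 2"
  have "(- (R - e)) *\<^sub>R e1 \<in> eccentric_annulus R r t"
    unfolding mem_annulus norm_scaleR_e1 using assms by (simp add: e_def field_simps abs_if)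
  then have "\<not> negligible (eccentric_annulus R r t)"
    using open_not_negligible[OF open_annulus] by blast
  moreover have "eccentric_annulus R r t \<in> lmeasurable"
    by (rule lmeasurable_open[OF _ open_annulus])
      (auto simp: eccentric_annulus_def intro: bounded_subset[OF bounded_ball])
  ultimately show ?thesis
    using negligible_iff_measure0 by (metis measure_nonneg order_le_less)
qed

theorem theorem1p9:
  fixes r R :: real
  assumes "0 < r" and "r < R" and "R < 1 / 2"
  shows "strict_mono_on {0..<R - r} (\<lambda>t. tau1 (eccentric_annulus R r t))"
proof (rule strict_mono_onI)
  fix t s assume t: "t \<in> {0..<R - r}" and s: "s \<in> {0..<R - r}" and "t < s"
  define a where "a = (s + t) / 2"
  let ?\<Omega> = "eccentric_annulus R r"
  have a: "0 < a" using t \<open>t < s\<close> by (simp add: a_def)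
  have sets: "?\<Omega> c \<in> sets lebesgue" for c using open_annulus[of R r c] by simp
  interpret t: small_domain "?\<Omega> t" by unfold_locales (rule sets, rule annulus_subset[OF assms(3)])
  interpret s: small_domain "?\<Omega> s" by unfold_locales (rule sets, rule annulus_subset[OF assms(3)])
  have "0 < measure lebesgue (?\<Omega> t)" by (rule measure_annulus_pos) (use assms t in auto)
  from t.tau1_variational(2)[OF this] obtain w where w: "w \<in> L2_on (?\<Omega> t)" "\<And>x. x \<in> ?\<Omega> t \<Longrightarrow> 0 < w x"
    and w_norm: "0 < (\<integral>x. (w x)\<^sup>2 \<partial>lebesgue_on (?\<Omega> t))"
    and w_energy: "log_energy (?\<Omega> t) w = tau1 (?\<Omega> t) * (\<integral>x. (w x)\<^sup>2 \<partial>lebesgue_on (?\<Omega> t))"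
    by blast
  define u where "u = (\<lambda>x. if x \<in> ?\<Omega> t then w x else 0)"
  define v where "v = polarize a u"
  have u: "u \<in> square_integrable lebesgue"
    unfolding u_def by (rule square_integrable_extend_zero[OF sets w(1)])
  have u_off: "u x = 0" if "x \<notin> ?\<Omega> t" for x using that by (simp add: u_def)
  have u_nonneg: "0 \<le> u x" for x using w(2)[of x] by (simp add: u_def less_imp_le)
  have u_pos: "0 < u x" if "x \<in> ?\<Omega> t" for x using w(2)[OF that] that by (simp add: u_def)
  have v_off: "v x = 0" if "x \<notin> ?\<Omega> s" for x
    unfolding v_def a_def
    by (rule polarize_vanishes_off_annulus[OF _ _ u_nonneg u_off that]) (use t \<open>t < s\<close> in auto)
  have v: "v \<in> square_integrable lebesgue" "(\<integral>x. (v x)\<^sup>2 \<partial>lebesgue) = (\<integral>x. (u x)\<^sup>2 \<partial>lebesgue)"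
    unfolding v_def by (rule polarize_square_integrable[OF u])+
  have norm_u: "(\<integral>x. (u x)\<^sup>2 \<partial>lebesgue) = (\<integral>x. (w x)\<^sup>2 \<partial>lebesgue_on (?\<Omega> t))"
  proof -
    have "(\<integral>x. (w x)\<^sup>2 \<partial>lebesgue_on (?\<Omega> t)) = (\<integral>x. (u x)\<^sup>2 \<partial>lebesgue_on (?\<Omega> t))"
      by (rule Bochner_Integration.integral_cong) (auto simp: u_def)
    then show ?thesis
      by (subst (asm) (2) integral_lebesgue_on_vanishing(1)) (simp_all add: sets u_off)
  qed
  have energy_u: "log_energy (?\<Omega> t) u = log_energy (?\<Omega> t) w"
    unfolding log_energy_def log_potential_def
    by (intro Bochner_Integration.integral_cong refl arg_cong2[of _ _ _ _ "(*)"]) (auto simp: u_def)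
  have sub: "?\<Omega> c \<subseteq> ball 0 (1/2)" for c by (rule annulus_subset[OF assms(3)])
  have "log_energy (?\<Omega> t) u = (\<integral>x. \<integral>y. log_kernel x y * (u x * u y) \<partial>lebesgue \<partial>lebesgue)"
    by (rule log_energy_eq_plane_integral) (rule sets, rule u_off)
  moreover have "log_energy (?\<Omega> s) v = (\<integral>x. \<integral>y. log_kernel x y * (v x * v y) \<partial>lebesgue \<partial>lebesgue)"
    by (rule log_energy_eq_plane_integral) (rule sets, rule v_off)
  moreover have "(\<integral>x. \<integral>y. log_kernel x y * (u x * u y) \<partial>lebesgue \<partial>lebesgue)
      < (\<integral>x. \<integral>y. log_kernel x y * (v x * v y) \<partial>lebesgue \<partial>lebesgue)"
    unfolding v_def
  proof (rule polarization_increases_energy[OF u])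
    show "u x = 0" "polarize a u x = 0" if "x \<notin> ball 0 (1/2)" for x
      using that sub u_off v_off unfolding v_def by blast+
    have refl_e1: "norm (reflect a x - t *\<^sub>R e1) = norm (x - s *\<^sub>R e1)" for x
      unfolding a_def by (rule norm_reflect_diff_e1)
    have refl_e1': "norm (reflect a x - s *\<^sub>R e1) = norm (x - t *\<^sub>R e1)" for x
      using refl_e1[of "reflect a x"] by simp
    show "\<not> (AE x in lebesgue. \<not> (x $ 1 < a \<and> u x < u (reflect a x)))"
    proof (rule open_imp_not_AE_avoided)
      \<comment> \<open>Points of the old hole, outside the new one: they get their mirror values.\<close>
      let ?U = "ball (t *\<^sub>R e1) r \<inter> - cball (s *\<^sub>R e1) r \<inter> {x. x $ 1 < a}"
      show "open ?U"
        by (intro open_Int open_ball open_Compl closed_cball open_Collect_less continuous_intros)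
      define d where "d = min r (s - t) / 2"
      have d: "0 < d" "d < r" "d < s - t" using assms(1) \<open>t < s\<close> by (auto simp: d_def min_def)
      \<comment> \<open>The leftmost point of the old hole, moved slightly inwards.\<close>
      show "(t - r + d) *\<^sub>R e1 \<in> ?U"
        using d by (simp add: dist_norm norm_scaleR_e1 a_def)
      fix x assume x: "x \<in> ?U"
      then have "u x = 0" by (intro u_off) (simp add: mem_annulus dist_norm norm_minus_commute)
      moreover have "reflect a x \<in> ?\<Omega> t"
      proof -
        have "norm (reflect a x) \<le> norm (reflect a x - s *\<^sub>R e1) + norm (s *\<^sub>R e1)"
          using norm_triangle_ineq[of "reflect a x - s *\<^sub>R e1" "s *\<^sub>R e1"] by simp
        also have "\<dots> < r + (R - r)"
          using x s by (simp add: refl_e1' norm_scaleR_e1 dist_norm norm_minus_commute)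
        finally show ?thesis using x by (simp add: mem_annulus refl_e1 dist_norm norm_minus_commute)
      qed
      ultimately show "x $ 1 < a \<and> u x < u (reflect a x)" using x u_pos by simp
    qed
    show "\<not> (AE y in lebesgue. \<not> (y $ 1 < a \<and> u (reflect a y) < u y))"
    proof (rule open_imp_not_AE_avoided)
      \<comment> \<open>Points near the left end of the disc: as $a > 0$, their mirror images leave the disc.\<close>
      let ?U = "?\<Omega> t \<inter> {y. R < norm (reflect a y)} \<inter> {y. y $ 1 < a}"
      show "open ?U"
        unfolding reflect_def
        by (intro open_Int open_annulus open_Collect_less continuous_intros)
      define d where "d = min (R - r) (2 * a) / 2"
      have d: "0 < d" "d < R - r" "d < 2 * a" using assms(2) a by (auto simp: d_def min_def)
      have "reflect a ((d - R) *\<^sub>R e1) = (2 * a + R - d) *\<^sub>R e1"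
        by (simp add: vec_eq_iff forall_2 reflect_nth axis_def)
      then show "(d - R) *\<^sub>R e1 \<in> ?U"
        using d a t assms by (simp add: mem_annulus norm_scaleR_e1)
      fix y assume y: "y \<in> ?U"
      then have "u (reflect a y) = 0" by (intro u_off) (simp add: mem_annulus)
      then show "y $ 1 < a \<and> u (reflect a y) < u y" using y u_pos by simp
    qed
  qed
  moreover have "log_energy (?\<Omega> s) v \<le> tau1 (?\<Omega> s) * (\<integral>x. (v x)\<^sup>2 \<partial>lebesgue_on (?\<Omega> s))"
  proof (rule s.tau1_variational(1))
    show "0 < measure lebesgue (?\<Omega> s)" by (rule measure_annulus_pos) (use assms s in auto)
    show "v \<in> L2_on (?\<Omega> s)"
      using square_integrable_lebesgue_on[OF v(1) sets, of s] by (simp only: s.L2_eq)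
  qed
  moreover have "(\<integral>x. (v x)\<^sup>2 \<partial>lebesgue_on (?\<Omega> s)) = (\<integral>x. (v x)\<^sup>2 \<partial>lebesgue)"
    by (rule integral_lebesgue_on_vanishing(1)) (simp_all add: sets v_off)
  ultimately have "tau1 (?\<Omega> t) * (\<integral>x. (u x)\<^sup>2 \<partial>lebesgue) < tau1 (?\<Omega> s) * (\<integral>x. (u x)\<^sup>2 \<partial>lebesgue)"
    by (simp add: energy_u w_energy norm_u v(2))
  then show "tau1 (?\<Omega> t) < tau1 (?\<Omega> s)"
    using w_norm by (simp add: norm_u)
qed

end
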